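(* Let $X=(X_t)_{t\ge0}$ be a real-valued Lévy process and, for $t>0$, $A_t=\int_0^t\mathbf 1\{X_s>0\}\,ds$. For every $m\ge1$ and $t>0$, $$\mathbb E[A_t^m]=\sum_{\rho\in\mathscr P_m}\int_0^t\Big(\mathop{\ast}_{B\in\rho}\big(u\mapsto u^{\#B-1}\,\mathbb P(X_u>0)\big)\Big)(s)\,ds.$$ In particular $\mathbb E[A_t]=\int_0^t\mathbb P(X_s>0)\,ds$ and $$\mathbb E[A_t^2]=\int_0^t s\,\mathbb P(X_s>0)\,ds+\int_0^t\int_0^s\mathbb P(X_u>0)\,\mathbb P(X_{s-u}>0)\,du\,ds.$$ These formulas remain valid if all strict inequalities (including the one in the definition of $A_t$) are replaced by weak inequalities.
   Context: A Lévy process is a càdlàg process with $X_0=0$ and stationary independent increments. $\mathscr P_m$ denotes the set of all partitions of $\{1,\dots,m\}$; $\#B$ is the cardinality of a block $B$. For $f,g:[0,\infty)\to\mathbb R$, $(f\ast g)(t)=\int_0^t f(t-s)g(s)\,ds$, and $\mathop{\ast}_{B\in\rho}$ denotes the iterated convolution over the blocks of $\rho$. *)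

theory Defs
  imports "HOL-Probability.Probability" "HOL-Library.Disjoint_Sets"
begin

definition cadlag :: "(real \<Rightarrow> real) \<Rightarrow> bool" where
  "cadlag f \<longleftrightarrow> (\<forall>t\<ge>0. continuous (at_right t) f) \<and>
                 (\<forall>t>0. \<exists>l. (f \<longlongrightarrow> l) (at_left t))"

definition levy_process :: "'a measure \<Rightarrow> (real \<Rightarrow> 'a \<Rightarrow> real) \<Rightarrow> bool" where
  "levy_process M X \<longleftrightarrow>
     prob_space M \<and>
     (\<forall>t\<ge>0. X t \<in> borel_measurable M) \<and>
     (\<forall>\<omega>\<in>space M. X 0 \<omega> = 0 \<and> cadlag (\<lambda>t. X t \<omega>)) \<and>
     (\<forall>s t. 0 \<le> s \<longrightarrow> s \<le> t \<longrightarrow>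
        distr M borel (\<lambda>\<omega>. X t \<omega> - X s \<omega>) = distr M borel (X (t - s))) \<and>
     (\<forall>(\<tau>::nat \<Rightarrow> real) n. 0 \<le> \<tau> 0 \<longrightarrow> mono \<tau> \<longrightarrow>
        prob_space.indep_vars M (\<lambda>_. borel) (\<lambda>i \<omega>. X (\<tau> (Suc i)) \<omega> - X (\<tau> i) \<omega>) {..<n})"

definition occ_time :: "(real \<Rightarrow> bool) \<Rightarrow> (real \<Rightarrow> 'a \<Rightarrow> real) \<Rightarrow> real \<Rightarrow> 'a \<Rightarrow> real" where
  "occ_time P X t \<omega> = (LINT s:{0..t}|lborel. (if P (X s \<omega>) then 1 else 0))"

definition conv :: "(real \<Rightarrow> real) \<Rightarrow> (real \<Rightarrow> real) \<Rightarrow> real \<Rightarrow> real" where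
  "conv f g t = (LINT s:{0..t}|lborel. f (t - s) * g s)"

fun conv_list :: "(real \<Rightarrow> real) list \<Rightarrow> real \<Rightarrow> real" where
  "conv_list [] = (\<lambda>_. 0)"
| "conv_list [f] = f"
| "conv_list (f # fs) = conv f (conv_list fs)"

definition blocks_list :: "nat set set \<Rightarrow> nat set list" where
  "blocks_list \<rho> = map (\<lambda>i. THE B. B \<in> \<rho> \<and> i \<in> B) (sorted_list_of_set (Min ` \<rho>))"

text \<open>Iterated convolution over the blocks of a partition (well defined since
  convolution is commutative and associative; we fix the order by least elements).\<close>
definition iconv :: "nat set set \<Rightarrow> (nat set \<Rightarrow> real \<Rightarrow> real) \<Rightarrow> real \<Rightarrow> real" where
  "iconv \<rho> F = conv_list (map F (blocks_list \<rho>))"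

end

theory Submission
  imports Defs
begin

text \<open>
  Expanding the power and ordering the time points, \<open>E[A\<^sub>t^m]\<close> is \<open>m!\<close> times the integral over
  \<open>s\<^sub>1 \<le> \<dots> \<le> s\<^sub>m \<le> t\<close> of the probability that \<open>X\<close> is positive at every \<open>s\<^sub>i\<close>. Let \<open>\<Lambda>\<close> be the
  measure \<open>dr P(X\<^sub>r \<in> dy)\<close> on time--space. By independence and stationarity of the increments that
  integral is the mass, up to time \<open>t\<close>, of the measure \<open>q\<^sub>m\<close> obtained from a unit mass at the origin
  by \<open>m\<close> times convolving with \<open>\<Lambda>\<close> and restricting to \<open>y > 0\<close>.

  Since both \<open>{y > 0}\<close> and its complement are closed under addition, the commutative convolution algebra
  gives Spitzer's recursion \<open>n q\<^sub>n = \<Sum>\<^sub>k c\<^sub>k \<star> q\<^sub>n\<^sub>-\<^sub>k\<close>, where \<open>c\<^sub>k\<close> is the restriction of the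
  \<open>k\<close>-fold convolution power of \<open>\<Lambda>\<close>, which by the semigroup property is
  \<open>u^(k-1) / (k-1)! du P(X\<^sub>u \<in> dy)\<close>. Splitting a set partition at the block of the least element yields
  the same recursion for the sum over partitions.
\<close>

section \<open>A Spitzer identity for convolution powers\<close>

text \<open>Why the recursion holds: let S and L be the generating series of \<open>stay\<close> and
  \<open>leave\<close>, with z marking the number of steps. One more step gives z \<Lambda> S = S -
  1 + L, hence S (1 - z \<Lambda>) = 1 - L, a Wiener-Hopf factorisation. The two closure properties
  put log S on \<open>U\<close> and log (1 - L) on its complement, so log S is the restriction to
  \<open>U\<close> of - log (1 - z \<Lambda>), the sum of z^n \<Lambda>^n / n; differentiating in z
  gives the recursion. The proof runs this as an induction on coefficients, without logarithms. The
  obstacle is that \<Lambda> is infinite on the half-line, whereas the convolution calculus is used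
  for finite measures. Time is therefore cut at a horizon \<open>T\<close>, and the cut measures are
  tested only on functions vanishing beyond \<open>T\<close>: durations are nonnegative and add up,
  so the cut is invisible to such functions. Integrals of test functions in \<open>ennreal\<close>
  spare all integrability questions until the end. Keeping time as a coordinate makes adding
  durations and adding positions one single convolution on the plane.\<close>

locale spitzer =
  fixes \<Lambda> :: "'a::ordered_euclidean_space measure" and U :: "'a set"
  assumes finite_Lam: "finite_measure \<Lambda>"
    and sets_Lam [measurable_cong, simp]: "sets \<Lambda> = sets borel"
    and U_meas [measurable]: "U \<in> sets borel"
    and U_add: "\<And>x y. x \<in> U \<Longrightarrow> y \<in> U \<Longrightarrow> x + y \<in> U"
    and U_compl_add: "\<And>x y. x \<notin> U \<Longrightarrow> y \<notin> U \<Longrightarrow> x + y \<notin> U"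
begin

primrec pw :: "nat \<Rightarrow> 'a measure" where
  "pw 0 = return borel 0"
| "pw (Suc n) = (\<Lambda> \<star> pw n)"

definition cyc :: "nat \<Rightarrow> 'a measure" where
  "cyc n = density (pw n) (indicator U)"

fun stay :: "nat \<Rightarrow> 'a measure" where
  "stay 0 = return borel 0"
| "stay (Suc n) = density (\<Lambda> \<star> stay n) (indicator U)"

text \<open>For n \<ge> 1 this is the first exit at step n of the walk with step measure \<Lambda>:
  the partial sums 1 to n - 1 lie in \<open>U\<close> and the n-th does not.\<close>

definition leave :: "nat \<Rightarrow> 'a measure" where
  "leave n = density (\<Lambda> \<star> stay (n - 1)) (indicator (- U))"

lemma finite_density_indicator:
  assumes "finite_measure N" "A \<in> sets N"
  shows "finite_measure (density N (indicator A))"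
  using assms by (intro finite_measureI)
    (simp add: emeasure_density finite_measure.emeasure_finite)

lemma sets_pw [measurable_cong, simp]: "sets (pw n) = sets borel"
  by (cases n) auto

lemma sets_stay [measurable_cong, simp]: "sets (stay n) = sets borel"
  by (cases n) auto

lemma sets_cyc [measurable_cong, simp]: "sets (cyc n) = sets borel"
  by (auto simp: cyc_def)

lemma sets_leave [measurable_cong, simp]: "sets (leave n) = sets borel"
  by (auto simp: leave_def)

lemma finite_pw: "finite_measure (pw n)"
proof (induction n)
  case 0
  show ?case by (simp add: prob_space.finite_measure prob_space_return)
qed (simp add: convolution_finite finite_Lam)

lemma finite_cyc: "finite_measure (cyc n)"
  unfolding cyc_def by (intro finite_density_indicator finite_pw) auto

lemma finite_stay: "finite_measure (stay n)"
proof (induction n)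
  case 0
  show ?case by (simp add: prob_space.finite_measure prob_space_return)
qed (simp add: finite_density_indicator convolution_finite finite_Lam)

lemma finite_leave: "finite_measure (leave n)"
  unfolding leave_def
  by (intro finite_density_indicator convolution_finite finite_Lam finite_stay) auto

lemmas finite_all = finite_Lam finite_pw finite_cyc finite_stay finite_leave

lemma measurable_nn_integral_shift [measurable]:
  assumes "finite_measure N" and [measurable_cong]: "sets N = sets borel"
    and [measurable]: "h \<in> borel_measurable borel"
  shows "(\<lambda>x. \<integral>\<^sup>+y. h (x + y) \<partial>N) \<in> borel_measurable (borel :: 'a measure)"
proof -
  interpret finite_measure N by fact
  show ?thesis by measurable
qed

lemma nn_integral_stay_Suc:
  assumes [measurable]: "h \<in> borel_measurable borel"
  shows "(\<integral>\<^sup>+x. h x \<partial>stay (Suc n)) = (\<integral>\<^sup>+x. \<integral>\<^sup>+y. indicator U (x + y) * h (x + y) \<partial>stay n \<partial>\<Lambda>)"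
  by (simp add: nn_integral_density nn_integral_convolution finite_all)

text \<open>One more step of a confined walk either stays or exits; this is the coefficient form of
  z \<Lambda> S = S - 1 + L.\<close>

lemma nn_integral_convolution_split:
  assumes [measurable]: "h \<in> borel_measurable borel"
  shows "(\<integral>\<^sup>+x. h x \<partial>(\<Lambda> \<star> stay n)) = (\<integral>\<^sup>+x. h x \<partial>stay (Suc n)) + (\<integral>\<^sup>+x. h x \<partial>leave (Suc n))"
  unfolding stay.simps leave_def
  by (simp add: nn_integral_density nn_integral_add[symmetric])
    (intro nn_integral_cong, auto split: split_indicator)

lemma nn_integral_return_convolution:
  fixes N :: "'a measure"
  assumes "finite_measure N" and [measurable_cong]: "sets N = sets borel"
    and [measurable]: "h \<in> borel_measurable borel"
  shows "(\<integral>\<^sup>+x. h x \<partial>(return borel 0 \<star> N)) = (\<integral>\<^sup>+x. h x \<partial>N)"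
  using assms measurable_nn_integral_shift[of N h]
  by (simp add: nn_integral_convolution prob_space.finite_measure prob_space_return nn_integral_return)

lemma AE_cyc: "AE x in cyc n. x \<in> U"
  unfolding cyc_def by (subst AE_density) (auto split: split_indicator)

text \<open>The index must be positive: \<open>stay 0\<close> is the unit mass at the origin, which
  is outside \<open>U\<close> when the inequality is strict.\<close>

lemma AE_stay:
  assumes "0 < n"
  shows "AE x in stay n. x \<in> U"
proof -
  obtain k where "n = Suc k"
    using assms gr0_conv_Suc by blast
  then show ?thesis
    by (simp only: stay.simps, subst AE_density) (auto split: split_indicator)
qed

lemma AE_leave: "AE x in leave n. x \<notin> U"
  unfolding leave_def by (subst AE_density) (auto split: split_indicator)

lemma nn_integral_cyc:
  assumes [measurable]: "h \<in> borel_measurable borel"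
  shows "(\<integral>\<^sup>+x. h x \<partial>cyc n) = (\<integral>\<^sup>+x. indicator U x * h x \<partial>pw n)"
  unfolding cyc_def by (simp add: nn_integral_density)

text \<open>Decomposition at the first exit k: confined before it, free after it. Convolving case n
  with \<Lambda> adds one free step to each exit term, while the confined term splits into
  \<open>stay (Suc n)\<close> and the new exit \<open>leave (Suc n)\<close>.\<close>

lemma pw_split:
  assumes [measurable]: "h \<in> borel_measurable borel"
  shows "(\<integral>\<^sup>+x. h x \<partial>pw n) = (\<integral>\<^sup>+x. h x \<partial>stay n) + (\<Sum>k=1..n. \<integral>\<^sup>+x. h x \<partial>(pw (n - k) \<star> leave k))"
  using assms
proof (induction n arbitrary: h)
  case 0
  then show ?case by simp
next
  case (Suc n)
  note [measurable] = Suc.prems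
  have conv3: "(\<integral>\<^sup>+x. \<integral>\<^sup>+y. h (x + y) \<partial>(pw (n - k) \<star> leave k) \<partial>\<Lambda>) = (\<integral>\<^sup>+x. h x \<partial>(pw (Suc n - k) \<star> leave k))"
    if "k \<in> {1..n}" for k
  proof -
    have "(\<integral>\<^sup>+x. \<integral>\<^sup>+y. h (x + y) \<partial>(pw (n - k) \<star> leave k) \<partial>\<Lambda>) = (\<integral>\<^sup>+x. h x \<partial>(\<Lambda> \<star> (pw (n - k) \<star> leave k)))"
      by (simp add: nn_integral_convolution finite_all convolution_finite)
    also have "(\<Lambda> \<star> (pw (n - k) \<star> leave k)) = (pw (Suc n - k) \<star> leave k)"
      using that by (simp add: convolution_associative finite_all Suc_diff_le)
    finally show ?thesis .
  qed
  have "(\<integral>\<^sup>+x. h x \<partial>pw (Suc n)) = (\<integral>\<^sup>+x. \<integral>\<^sup>+y. h (x + y) \<partial>pw n \<partial>\<Lambda>)"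
    by (simp add: nn_integral_convolution finite_all)
  also have "\<dots> = (\<integral>\<^sup>+x. ((\<integral>\<^sup>+y. h (x + y) \<partial>stay n) + (\<Sum>k=1..n. \<integral>\<^sup>+y. h (x + y) \<partial>(pw (n - k) \<star> leave k))) \<partial>\<Lambda>)"
    by (intro nn_integral_cong Suc.IH) auto
  also have "\<dots> = (\<integral>\<^sup>+x. \<integral>\<^sup>+y. h (x + y) \<partial>stay n \<partial>\<Lambda>)
      + (\<Sum>k=1..n. \<integral>\<^sup>+x. \<integral>\<^sup>+y. h (x + y) \<partial>(pw (n - k) \<star> leave k) \<partial>\<Lambda>)"
    by (subst nn_integral_add)
      (auto intro!: borel_measurable_sum nn_integral_sum measurable_nn_integral_shift
        finite_all convolution_finite simp: measurable_cong_sets[OF sets_Lam refl])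
  also have "(\<integral>\<^sup>+x. \<integral>\<^sup>+y. h (x + y) \<partial>stay n \<partial>\<Lambda>) = (\<integral>\<^sup>+x. h x \<partial>stay (Suc n)) + (\<integral>\<^sup>+x. h x \<partial>leave (Suc n))"
    by (subst nn_integral_convolution_split[symmetric]) (auto simp: nn_integral_convolution finite_all)
  also have "(\<Sum>k=1..n. \<integral>\<^sup>+x. \<integral>\<^sup>+y. h (x + y) \<partial>(pw (n - k) \<star> leave k) \<partial>\<Lambda>)
      = (\<Sum>k=1..n. \<integral>\<^sup>+x. h x \<partial>(pw (Suc n - k) \<star> leave k))"
    using conv3 by (intro sum.cong) auto
  \<comment> \<open>Padding with the unit mass \<open>pw 0\<close> turns the new exit into the
    summand k = Suc n.\<close>
  also have "(\<integral>\<^sup>+x. h x \<partial>leave (Suc n)) = (\<integral>\<^sup>+x. h x \<partial>(pw 0 \<star> leave (Suc n)))"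
    by (simp add: nn_integral_return_convolution finite_all)
  finally show ?case
    by (simp add: add_ac)
qed

text \<open>Both factors live on \<open>U\<close>, which is closed under addition, so restricting
  their convolution to \<open>U\<close> loses nothing.\<close>

lemma nn_integral_cyc_convolution_U:
  assumes "finite_measure N" and [measurable_cong, simp]: "sets N = sets borel"
    and AE: "AE x in N. x \<in> U" and [measurable]: "h \<in> borel_measurable borel"
  shows "(\<integral>\<^sup>+x. indicator U x * h x \<partial>(cyc k \<star> N)) = (\<integral>\<^sup>+x. h x \<partial>(cyc k \<star> N))"
  using AE_cyc[of k] assms(1)
  by (simp add: nn_integral_convolution finite_all)
     (intro nn_integral_cong_AE, use AE in \<open>auto intro!: nn_integral_cong_AE elim!: eventually_mono simp: U_add\<close>)

text \<open>If a sum is in \<open>U\<close> and its second summand is not, then the first summand is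
  in \<open>U\<close>, because the complement is closed under addition. So \<open>pw j\<close> may
  be exchanged for its restriction \<open>cyc j\<close>.\<close>

lemma nn_integral_pw_leave:
  assumes [measurable]: "h \<in> borel_measurable borel"
  shows "(\<integral>\<^sup>+x. indicator U x * h x \<partial>(pw j \<star> leave k)) = (\<integral>\<^sup>+x. indicator U x * h x \<partial>(cyc j \<star> leave k))"
proof -
  have "(\<integral>\<^sup>+x. indicator U x * h x \<partial>(pw j \<star> leave k))
      = (\<integral>\<^sup>+x. \<integral>\<^sup>+y. indicator U (x + y) * h (x + y) \<partial>leave k \<partial>pw j)"
    by (simp add: nn_integral_convolution finite_all)
  also have "\<dots> = (\<integral>\<^sup>+x. indicator U x * (\<integral>\<^sup>+y. indicator U (x + y) * h (x + y) \<partial>leave k) \<partial>pw j)"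
  proof (intro nn_integral_cong)
    fix x
    have "(\<integral>\<^sup>+y. indicator U (x + y) * h (x + y) \<partial>leave k) = 0" if "x \<notin> U"
      using AE_leave[of k] that
      by (subst nn_integral_0_iff_AE) (auto elim!: eventually_mono simp: U_compl_add)
    then show "(\<integral>\<^sup>+y. indicator U (x + y) * h (x + y) \<partial>leave k)
        = indicator U x * (\<integral>\<^sup>+y. indicator U (x + y) * h (x + y) \<partial>leave k)"
      by (auto split: split_indicator)
  qed
  also have "\<dots> = (\<integral>\<^sup>+x. indicator U x * h x \<partial>(cyc j \<star> leave k))"
    by (simp add: nn_integral_convolution finite_all nn_integral_cyc measurable_nn_integral_shift)
  finally show ?thesis .
qed

text \<open>In the induction step, n copies of \<open>stay (Suc n)\<close> are expanded by the
  hypothesis, and the extra \<Lambda> is moved onto the confined factor, where it splits. The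
  \<open>stay\<close> parts are the wanted summands k \<le> n. The \<open>leave\<close> parts,
  joined by the one remaining copy of \<open>stay (Suc n)\<close>, form the first-exit decomposition
  of \<open>pw (Suc n)\<close> restricted to \<open>U\<close>, which is the missing summand k = Suc
  n.\<close>

theorem spitzer_recursion:
  assumes [measurable]: "h \<in> borel_measurable borel"
  shows "of_nat n * (\<integral>\<^sup>+x. h x \<partial>stay n) = (\<Sum>k=1..n. \<integral>\<^sup>+x. h x \<partial>(cyc k \<star> stay (n - k)))"
  using assms
proof (induction n arbitrary: h)
  case 0
  then show ?case by simp
next
  case (Suc n)
  note [measurable] = Suc.prems
  \<comment> \<open>With the restriction to \<open>U\<close> placed in the test function, the
    hypothesis can be applied to the translates of \<open>g\<close>.\<close>
  define g where "g x = indicator U x * h x" for x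
  have g [measurable]: "g \<in> borel_measurable borel"
    unfolding g_def by measurable
  have comm: "(\<integral>\<^sup>+x. \<integral>\<^sup>+y. g (x + y) \<partial>(cyc k \<star> stay (n - k)) \<partial>\<Lambda>)
     = (\<integral>\<^sup>+x. g x \<partial>(cyc k \<star> stay (Suc n - k))) + (\<integral>\<^sup>+x. g x \<partial>(cyc k \<star> leave (Suc n - k)))"
    if "k \<in> {1..n}" for k
  proof -
    have "(\<integral>\<^sup>+x. \<integral>\<^sup>+y. g (x + y) \<partial>(cyc k \<star> stay (n - k)) \<partial>\<Lambda>) = (\<integral>\<^sup>+x. g x \<partial>(\<Lambda> \<star> (cyc k \<star> stay (n - k))))"
      by (simp add: nn_integral_convolution finite_all convolution_finite)
    \<comment> \<open>Commutativity enters here: the new step passes \<open>cyc k\<close> to reach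
      the confined walk.\<close>
    also have "(\<Lambda> \<star> (cyc k \<star> stay (n - k))) = (cyc k \<star> (\<Lambda> \<star> stay (n - k)))"
      by (simp add: convolution_associative convolution_commutative[of \<Lambda> "cyc k"] finite_all)
    also have "(\<integral>\<^sup>+x. g x \<partial>(cyc k \<star> (\<Lambda> \<star> stay (n - k))))
       = (\<integral>\<^sup>+x. \<integral>\<^sup>+y. g (x + y) \<partial>(\<Lambda> \<star> stay (n - k)) \<partial>cyc k)"
      by (simp add: nn_integral_convolution[of "cyc k"] finite_all convolution_finite)
    also have "\<dots> = (\<integral>\<^sup>+x. (\<integral>\<^sup>+y. g (x + y) \<partial>stay (Suc (n - k))) + (\<integral>\<^sup>+y. g (x + y) \<partial>leave (Suc (n - k))) \<partial>cyc k)"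
      by (intro nn_integral_cong nn_integral_convolution_split) auto
    also have "\<dots> = (\<integral>\<^sup>+x. \<integral>\<^sup>+y. g (x + y) \<partial>stay (Suc (n - k)) \<partial>cyc k)
        + (\<integral>\<^sup>+x. \<integral>\<^sup>+y. g (x + y) \<partial>leave (Suc (n - k)) \<partial>cyc k)"
      by (intro nn_integral_add)
        (auto simp del: stay.simps simp: measurable_cong_sets[OF sets_cyc refl] intro!: measurable_nn_integral_shift finite_all)
    finally show ?thesis
      using that by (simp add: nn_integral_convolution finite_all Suc_diff_le del: stay.simps)
  qed
  have stay: "(\<integral>\<^sup>+x. h x \<partial>stay (Suc n)) = (\<integral>\<^sup>+x. \<integral>\<^sup>+y. g (x + y) \<partial>stay n \<partial>\<Lambda>)"
    unfolding g_def by (rule nn_integral_stay_Suc) fact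
  have stay_g: "(\<integral>\<^sup>+x. g x \<partial>stay (Suc n)) = (\<integral>\<^sup>+x. h x \<partial>stay (Suc n))"
    using AE_stay[of "Suc n"] by (intro nn_integral_cong_AE) (auto simp: g_def elim!: eventually_mono)
  have "of_nat n * (\<integral>\<^sup>+x. h x \<partial>stay (Suc n)) = (\<integral>\<^sup>+x. of_nat n * \<integral>\<^sup>+y. g (x + y) \<partial>stay n \<partial>\<Lambda>)"
    unfolding stay by (simp add: nn_integral_cmult measurable_nn_integral_shift finite_all)
  also have "\<dots> = (\<integral>\<^sup>+x. (\<Sum>k=1..n. \<integral>\<^sup>+y. g (x + y) \<partial>(cyc k \<star> stay (n - k))) \<partial>\<Lambda>)"
    by (intro nn_integral_cong Suc.IH) auto
  also have "\<dots> = (\<Sum>k=1..n. \<integral>\<^sup>+x. \<integral>\<^sup>+y. g (x + y) \<partial>(cyc k \<star> stay (n - k)) \<partial>\<Lambda>)"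
    by (intro nn_integral_sum)
      (auto intro!: measurable_nn_integral_shift finite_all convolution_finite simp: measurable_cong_sets[OF sets_Lam refl])
  also have "\<dots> = (\<Sum>k=1..n. (\<integral>\<^sup>+x. g x \<partial>(cyc k \<star> stay (Suc n - k))) + (\<integral>\<^sup>+x. g x \<partial>(cyc k \<star> leave (Suc n - k))))"
    using comm by (intro sum.cong) auto
  also have "\<dots> = (\<Sum>k=1..n. (\<integral>\<^sup>+x. h x \<partial>(cyc k \<star> stay (Suc n - k)))) + (\<Sum>k=1..n. \<integral>\<^sup>+x. g x \<partial>(cyc k \<star> leave (Suc n - k)))"
    \<comment> \<open>Since k \<le> n, the index Suc n - k is positive, as \<open>AE_stay\<close>
      demands.\<close>
    unfolding sum.distrib g_def
    by (intro arg_cong2[where f="(+)"] sum.cong refl nn_integral_cyc_convolution_U finite_all Suc.prems)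
      (auto intro: AE_stay)
  finally have step: "of_nat n * (\<integral>\<^sup>+x. h x \<partial>stay (Suc n)) = \<dots>" .
  have "(\<Sum>k=1..n. \<integral>\<^sup>+x. g x \<partial>(cyc k \<star> leave (Suc n - k))) = (\<Sum>k=1..n. \<integral>\<^sup>+x. g x \<partial>(cyc (Suc n - k) \<star> leave k))"
    by (rule sum.reindex_bij_witness[of _ "\<lambda>k. Suc n - k" "\<lambda>k. Suc n - k"]) auto
  also have "\<dots> = (\<Sum>k=1..n. \<integral>\<^sup>+x. g x \<partial>(pw (Suc n - k) \<star> leave k))"
    unfolding g_def by (intro sum.cong refl nn_integral_pw_leave[symmetric] Suc.prems)
  \<comment> \<open>The added summand k = Suc n is zero: a walk that exits at its last step ends
    outside \<open>U\<close>, where \<open>g\<close> vanishes.\<close>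
  also have "\<dots> = (\<Sum>k=1..Suc n. \<integral>\<^sup>+x. g x \<partial>(pw (Suc n - k) \<star> leave k))"
  proof -
    have "(\<integral>\<^sup>+x. g x \<partial>(pw 0 \<star> leave (Suc n))) = (\<integral>\<^sup>+x. g x \<partial>leave (Suc n))"
      by (simp add: nn_integral_return_convolution finite_all)
    also have "\<dots> = 0"
      using AE_leave[of "Suc n"] by (subst nn_integral_0_iff_AE) (auto simp: g_def elim!: eventually_mono)
    finally show ?thesis by simp
  qed
  finally have "(\<integral>\<^sup>+x. h x \<partial>stay (Suc n)) + (\<Sum>k=1..n. \<integral>\<^sup>+x. g x \<partial>(cyc k \<star> leave (Suc n - k))) = (\<integral>\<^sup>+x. g x \<partial>pw (Suc n))"
    unfolding stay_g[symmetric] pw_split[OF g, of "Suc n"] by (rule arg_cong)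
  \<comment> \<open>\<open>stay 0\<close> is the unit of convolution, so this is already the summand
    k = Suc n of the claim.\<close>
  also have "\<dots> = (\<integral>\<^sup>+x. h x \<partial>(cyc (Suc n) \<star> stay 0))"
    by (simp add: convolution_commutative[of "cyc (Suc n)"] nn_integral_return_convolution
        finite_all prob_space.finite_measure prob_space_return nn_integral_cyc g_def)
  finally have eq: "(\<integral>\<^sup>+x. h x \<partial>stay (Suc n)) + (\<Sum>k=1..n. \<integral>\<^sup>+x. g x \<partial>(cyc k \<star> leave (Suc n - k)))
      = (\<integral>\<^sup>+x. h x \<partial>(cyc (Suc n) \<star> stay 0))" .
  have "of_nat (Suc n) * (\<integral>\<^sup>+x. h x \<partial>stay (Suc n)) = (\<integral>\<^sup>+x. h x \<partial>stay (Suc n)) + of_nat n * (\<integral>\<^sup>+x. h x \<partial>stay (Suc n))"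
    by (simp add: distrib_right)
  also have "\<dots> = (\<Sum>k=1..n. (\<integral>\<^sup>+x. h x \<partial>(cyc k \<star> stay (Suc n - k))))
     + ((\<integral>\<^sup>+x. h x \<partial>stay (Suc n)) + (\<Sum>k=1..n. \<integral>\<^sup>+x. g x \<partial>(cyc k \<star> leave (Suc n - k))))"
    unfolding step by (simp add: add_ac)
  also have "\<dots> = (\<Sum>k=1..Suc n. \<integral>\<^sup>+x. h x \<partial>(cyc k \<star> stay (Suc n - k)))"
    unfolding eq by simp
  finally show ?case .
qed

end

section \<open>Independence of increments from the past\<close>

lemma borel_measurable_fst_snd [measurable]:
  shows "fst \<in> borel_measurable (borel :: ('a::topological_space \<times> 'b::topological_space) measure)"
    and "snd \<in> borel_measurable (borel :: ('a \<times> 'b) measure)"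
  by (intro borel_measurable_continuous_onI continuous_intros)+

text \<open>Time is rounded up to a grid of mesh 1 / (n + 1). The rounded process uses only
  countably many times, so it is jointly measurable, and right continuity makes it converge
  pointwise.\<close>

lemma measurable_pair_right_continuous:
  fixes W :: "real \<Rightarrow> 'a \<Rightarrow> 'b::metric_space"
  assumes meas: "\<And>s. W s \<in> borel_measurable F"
    and cont: "\<And>s \<omega>. \<omega> \<in> space F \<Longrightarrow> continuous (at_right s) (\<lambda>s. W s \<omega>)"
  shows "(\<lambda>(s, \<omega>). W s \<omega>) \<in> borel_measurable (borel \<Otimes>\<^sub>M F)"
proof (rule borel_measurable_LIMSEQ_metric)
  \<comment> \<open>Floor plus one instead of the ceiling keeps \<open>r n s\<close> strictly above
    s, as the filter \<open>at_right s\<close> excludes s itself.\<close>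
  define r :: "nat \<Rightarrow> real \<Rightarrow> real" where "r n s = real_of_int (\<lfloor>real (Suc n) * s\<rfloor> + 1) / real (Suc n)" for n s
  note [measurable] = meas
  show "(\<lambda>(s, \<omega>). W (r n s) \<omega>) \<in> borel_measurable (borel \<Otimes>\<^sub>M F)" for n
  proof -
    have "(\<lambda>x. (\<lambda>k x. W (real_of_int (k + 1) / real (Suc n)) (snd x)) \<lfloor>real (Suc n) * fst x\<rfloor> x)
        \<in> borel_measurable (borel \<Otimes>\<^sub>M F)"
      by (rule measurable_compose_countable) measurable
    then show ?thesis
      by (simp add: r_def case_prod_beta')
  qed
  show "(\<lambda>n. case x of (s, \<omega>) \<Rightarrow> W (r n s) \<omega>) \<longlonglongrightarrow> (case x of (s, \<omega>) \<Rightarrow> W s \<omega>)"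
    if x_in: "x \<in> space (borel \<Otimes>\<^sub>M F)" for x
  proof -
    obtain s \<omega> where x: "x = (s, \<omega>)" "\<omega> \<in> space F"
      using x_in by (auto simp: space_pair_measure)
    have gt: "s < r n s" and le: "r n s \<le> s + inverse (real (Suc n))" for n
    proof -
      have "real (Suc n) * s < real_of_int (\<lfloor>real (Suc n) * s\<rfloor> + 1)"
        by linarith
      then show "s < r n s"
        unfolding r_def by (simp add: field_simps)
      have "real_of_int (\<lfloor>real (Suc n) * s\<rfloor> + 1) \<le> real (Suc n) * s + 1"
        by linarith
      then have "r n s \<le> (real (Suc n) * s + 1) / real (Suc n)"
        unfolding r_def by (intro divide_right_mono) auto
      then show "r n s \<le> s + inverse (real (Suc n))"
        by (simp add: add_divide_distrib inverse_eq_divide)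
    qed
    have "(\<lambda>n. r n s) \<longlonglongrightarrow> s"
    proof (rule tendsto_sandwich[OF _ _ tendsto_const])
      show "(\<lambda>n. s + inverse (real (Suc n))) \<longlonglongrightarrow> s"
        using tendsto_add[OF tendsto_const LIMSEQ_inverse_real_of_nat, of s] by simp
    qed (use gt le in \<open>auto intro!: always_eventually simp: less_imp_le simp del: of_nat_Suc\<close>)
    moreover have "r n s \<noteq> s" for n
      using gt[of n] by simp
    ultimately have "filterlim (\<lambda>n. r n s) (at_right s) sequentially"
      using gt by (auto simp: filterlim_at)
    with cont[OF x(2), of s] show ?thesis
      unfolding x by (auto simp: continuous_within intro: filterlim_compose)
  qed
qed

locale levy = prob_space M for M :: "'a measure" +
  fixes X :: "real \<Rightarrow> 'a \<Rightarrow> real"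
  assumes levy: "levy_process M X"
begin

text \<open>Nothing is known about \<^term>\<open>X s\<close> for \<^term>\<open>s < 0\<close>, hence the clipped time.\<close>
definition Y :: "real \<Rightarrow> 'a \<Rightarrow> real" where
  "Y s \<omega> = X (max 0 s) \<omega>"

lemma Y_nonneg [simp]: "0 \<le> s \<Longrightarrow> Y s = X s"
  by (auto simp: Y_def)

lemma measurable_Y [measurable]: "Y s \<in> borel_measurable M"
  using levy by (auto simp: levy_process_def Y_def[abs_def])

lemma Y_nonpos: "\<omega> \<in> space M \<Longrightarrow> s \<le> 0 \<Longrightarrow> Y s \<omega> = 0"
  using levy by (auto simp: levy_process_def Y_def max_def)

lemma right_continuous_Y:
  assumes "\<omega> \<in> space M"
  shows "continuous (at_right s) (\<lambda>s. Y s \<omega>)"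
proof (cases "0 \<le> s")
  case True
  then have "continuous (at_right s) (\<lambda>s. X s \<omega>)"
    using levy assms by (auto simp: levy_process_def cadlag_def)
  moreover have "\<forall>\<^sub>F x in at_right s. X x \<omega> = Y x \<omega>"
    using True by (auto simp: eventually_at_filter)
  ultimately have "((\<lambda>s. Y s \<omega>) \<longlongrightarrow> X s \<omega>) (at_right s)"
    unfolding continuous_within by (rule Lim_transform_eventually)
  then show ?thesis
    using True by (simp add: continuous_within)
next
  case False
  have "\<forall>\<^sub>F x in at_right s. 0 = Y x \<omega>"
    using False assms by (intro eventually_at_rightI[of s 0]) (auto simp: Y_nonpos)
  then have "((\<lambda>s. Y s \<omega>) \<longlongrightarrow> 0) (at_right s)"
    by (rule Lim_transform_eventually[OF tendsto_const])
  then show ?thesis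
    using False assms by (simp add: continuous_within Y_nonpos)
qed

lemma measurable_Y_pair [measurable]: "(\<lambda>(s, \<omega>). Y s \<omega>) \<in> borel_measurable (borel \<Otimes>\<^sub>M M)"
  by (intro measurable_pair_right_continuous right_continuous_Y) auto

text \<open>As X starts at 0, its values at the sorted points of J are partial sums of increments
  before u. The increment from u to s has an index outside that group, and disjoint groups of
  independent increments are independent.\<close>

lemma indep_cylinder_increment:
  assumes "0 \<le> u" "u \<le> s" "finite J" "J \<subseteq> {0..u}"
    and A: "\<And>v. v \<in> J \<Longrightarrow> A v \<in> sets borel" and B: "B \<in> sets borel"
  shows "prob ({\<omega>\<in>space M. \<forall>v\<in>J. X v \<omega> \<in> A v} \<inter> {\<omega>\<in>space M. X s \<omega> - X u \<omega> \<in> B})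
    = prob {\<omega>\<in>space M. \<forall>v\<in>J. X v \<omega> \<in> A v} * prob {\<omega>\<in>space M. X s \<omega> - X u \<omega> \<in> B}"
proof -
  define xs where "xs = sorted_list_of_set J"
  define n where "n = length xs"
  have xs: "sorted xs" "set xs = J"
    using assms by (auto simp: xs_def)
  have xs_le: "xs ! i \<le> u" "0 \<le> xs ! i" if "i < n" for i
    using that xs assms nth_mem[of i xs] by (auto simp: n_def)
  \<comment> \<open>Index 0 is time 0, then come the n points of J, then u at index Suc n, then s.
    Hence increment number Suc n is \<open>X s - X u\<close>, and the constant tail keeps \<tau>
    monotone on all of nat.\<close>
  define \<tau> where "\<tau> i = (if i = 0 then 0 else if i \<le> n then xs ! (i - 1) else if i = Suc n then u else s)" for i
  have "\<tau> i \<le> \<tau> (Suc i)" for i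
    using xs_le[of 0] xs_le[of "i - 1"] assms(1,2) sorted_nth_mono[OF xs(1), of "i - 1" i]
    by (auto simp: \<tau>_def n_def)
  then have "mono \<tau>"
    by (simp add: mono_iff_le_Suc)
  moreover have "0 \<le> \<tau> 0"
    by (simp add: \<tau>_def)
  ultimately have ind: "indep_vars (\<lambda>_. borel) (\<lambda>i \<omega>. X (\<tau> (Suc i)) \<omega> - X (\<tau> i) \<omega>) {..<Suc (Suc n)}"
    using levy by (auto simp: levy_process_def)
  let ?d = "\<lambda>i \<omega>. X (\<tau> (Suc i)) \<omega> - X (\<tau> i) \<omega>"
  have ind2: "indep_var (PiM {..<Suc n} (\<lambda>_. borel)) (\<lambda>\<omega>. restrict (\<lambda>i. ?d i \<omega>) {..<Suc n})
        (PiM {Suc n} (\<lambda>_. borel)) (\<lambda>\<omega>. restrict (\<lambda>i. ?d i \<omega>) {Suc n})"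
    by (rule indep_var_restrict[OF ind]) auto
  define C1 where "C1 = {y \<in> space (PiM {..<Suc n} (\<lambda>_. borel :: real measure)).
      \<forall>i\<in>{..<n}. (\<Sum>j<Suc i. y j) \<in> A (xs ! i)}"
  define C2 where "C2 = {y \<in> space (PiM {Suc n} (\<lambda>_. borel :: real measure)). y (Suc n) \<in> B}"
  have A': "A (xs ! i) \<in> sets borel" if "i < n" for i
    using that xs nth_mem[of i xs] by (auto simp: n_def intro!: A)
  have "{y \<in> space (PiM {..<Suc n} (\<lambda>_. borel :: real measure)). (\<Sum>j<Suc i. y j) \<in> A (xs ! i)}
      \<in> sets (PiM {..<Suc n} (\<lambda>_. borel))" if "i < n" for i
  proof -
    have [measurable]: "(\<lambda>y. \<Sum>j<Suc i. y j) \<in> borel_measurable (PiM {..<Suc n} (\<lambda>_. borel :: real measure))"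
      using that by (intro borel_measurable_sum measurable_component_singleton) auto
    show ?thesis
      using A'[OF that] by measurable
  qed
  then have C1: "C1 \<in> sets (PiM {..<Suc n} (\<lambda>_. borel))"
    unfolding C1_def by (intro sets.sets_Collect_finite_All) auto
  have C2: "C2 \<in> sets (PiM {Suc n} (\<lambda>_. borel))"
    unfolding C2_def using B by measurable
  have tele: "(\<Sum>j<Suc i. ?d j \<omega>) = X (xs ! i) \<omega>" if "i < n" "\<omega> \<in> space M" for i \<omega>
  proof -
    have "(\<Sum>j<Suc i. ?d j \<omega>) = X (\<tau> (Suc i)) \<omega> - X (\<tau> 0) \<omega>"
      by (rule sum_lessThan_telescope)
    then show ?thesis
      using that levy by (simp add: \<tau>_def levy_process_def)
  qed
  have E1: "(\<lambda>\<omega>. restrict (\<lambda>i. ?d i \<omega>) {..<Suc n}) -` C1 \<inter> space M = {\<omega>\<in>space M. \<forall>v\<in>J. X v \<omega> \<in> A v}"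
  proof -
    have "(\<forall>i\<in>{..<n}. (\<Sum>j<Suc i. restrict (\<lambda>i. ?d i \<omega>) {..<Suc n} j) \<in> A (xs ! i)) \<longleftrightarrow> (\<forall>v\<in>J. X v \<omega> \<in> A v)"
      if \<omega>: "\<omega> \<in> space M" for \<omega>
    proof -
      have "(\<Sum>j<Suc i. restrict (\<lambda>i. ?d i \<omega>) {..<Suc n} j) = X (xs ! i) \<omega>" if "i < n" for i
        unfolding tele[OF that \<omega>, symmetric] using that by (intro sum.cong) auto
      then have "(\<forall>i\<in>{..<n}. (\<Sum>j<Suc i. restrict (\<lambda>i. ?d i \<omega>) {..<Suc n} j) \<in> A (xs ! i))
         \<longleftrightarrow> (\<forall>i\<in>{..<n}. X (xs ! i) \<omega> \<in> A (xs ! i))"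
        by (intro ball_cong refl) (simp only: lessThan_iff)
      also have "\<dots> \<longleftrightarrow> (\<forall>v\<in>J. X v \<omega> \<in> A v)"
        unfolding xs(2)[symmetric] n_def by (auto simp: all_set_conv_all_nth)
      finally show ?thesis .
    qed
    moreover have "restrict (\<lambda>i. ?d i \<omega>) {..<Suc n} \<in> space (PiM {..<Suc n} (\<lambda>_. borel))" for \<omega>
      by (simp add: space_PiM)
    ultimately show ?thesis
      unfolding C1_def by blast
  qed
  have E2: "(\<lambda>\<omega>. restrict (\<lambda>i. ?d i \<omega>) {Suc n}) -` C2 \<inter> space M = {\<omega>\<in>space M. X s \<omega> - X u \<omega> \<in> B}"
    by (auto simp: C2_def space_PiM \<tau>_def)
  have "prob ((\<lambda>\<omega>. (restrict (\<lambda>i. ?d i \<omega>) {..<Suc n}, restrict (\<lambda>i. ?d i \<omega>) {Suc n})) -` (C1 \<times> C2) \<inter> space M)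
      = prob ((\<lambda>\<omega>. restrict (\<lambda>i. ?d i \<omega>) {..<Suc n}) -` C1 \<inter> space M)
      * prob ((\<lambda>\<omega>. restrict (\<lambda>i. ?d i \<omega>) {Suc n}) -` C2 \<inter> space M)"
    by (rule indep_varD[OF ind2 C1 C2])
  also have "(\<lambda>\<omega>. (restrict (\<lambda>i. ?d i \<omega>) {..<Suc n}, restrict (\<lambda>i. ?d i \<omega>) {Suc n})) -` (C1 \<times> C2) \<inter> space M
     = {\<omega>\<in>space M. \<forall>v\<in>J. X v \<omega> \<in> A v} \<inter> {\<omega>\<in>space M. X s \<omega> - X u \<omega> \<in> B}"
    unfolding E1[symmetric] E2[symmetric] by auto
  finally show ?thesis
    unfolding E1 E2 .
qed

section \<open>The natural filtration and the Markov property\<close>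

definition cylinders :: "real \<Rightarrow> 'a set set" where
  "cylinders u = {{\<omega>\<in>space M. \<forall>v\<in>J. X v \<omega> \<in> A v} | J A.
     finite J \<and> J \<subseteq> {0..u} \<and> (\<forall>v\<in>J. A v \<in> sets borel)}"

text \<open>The sigma-algebra at time u of the natural filtration, packaged as a measure so that
  \<open>measurable\<close> can refer to it.\<close>

definition past :: "real \<Rightarrow> 'a measure" where
  "past u = sigma (space M) (cylinders u)"

lemma cylinders_sub: "cylinders u \<subseteq> sets M"
proof -
  have "{\<omega>\<in>space M. \<forall>v\<in>J. X v \<omega> \<in> A v} \<in> sets M"
    if "finite J" "J \<subseteq> {0..u}" "\<forall>v\<in>J. A v \<in> sets borel" for J A
  proof (intro sets.sets_Collect_finite_All that)
    fix v assume v: "v \<in> J"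
    then have [measurable]: "X v \<in> borel_measurable M" "A v \<in> sets borel"
      using that levy by (auto simp: levy_process_def)
    show "{\<omega>\<in>space M. X v \<omega> \<in> A v} \<in> sets M"
      by measurable
  qed
  then show ?thesis
    unfolding cylinders_def by blast
qed

lemma cylinders_Pow: "cylinders u \<subseteq> Pow (space M)"
  by (auto simp: cylinders_def)

lemma space_past [simp]: "space (past u) = space M"
  using cylinders_Pow by (simp add: past_def space_measure_of)

lemma sets_past: "sets (past u) = sigma_sets (space M) (cylinders u)"
  using cylinders_Pow by (simp add: past_def sets_measure_of)

lemma sets_past_sub: "sets (past u) \<subseteq> sets M"
  unfolding sets_past by (intro sets.sigma_sets_subset cylinders_sub)

lemma measurable_past:
  assumes "v \<le> u" "0 \<le> u"
  shows "Y v \<in> borel_measurable (past u)"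
proof (rule measurableI)
  fix A :: "real set" assume A: "A \<in> sets borel"
  let ?v = "max 0 v"
  have "{\<omega>\<in>space M. \<forall>v\<in>{?v}. X v \<omega> \<in> (\<lambda>_. A) v} \<in> cylinders u"
    unfolding cylinders_def using A assms
    by (intro CollectI exI[of _ "{?v}"] exI[of _ "\<lambda>_. A"]) auto
  moreover have "{\<omega>\<in>space M. \<forall>v\<in>{?v}. X v \<omega> \<in> (\<lambda>_. A) v} = Y v -` A \<inter> space (past u)"
    by (auto simp: Y_def)
  ultimately show "Y v -` A \<inter> space (past u) \<in> sets (past u)"
    by (auto simp: sets_past)
qed auto

lemma Int_stable_cylinders: "Int_stable (cylinders u)"
proof (rule Int_stableI)
  fix a b assume "a \<in> cylinders u" "b \<in> cylinders u"
  then obtain J A K B where a: "a = {\<omega>\<in>space M. \<forall>v\<in>J. X v \<omega> \<in> A v}" "finite J" "J \<subseteq> {0..u}" "\<forall>v\<in>J. A v \<in> sets borel"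
    and b: "b = {\<omega>\<in>space M. \<forall>v\<in>K. X v \<omega> \<in> B v}" "finite K" "K \<subseteq> {0..u}" "\<forall>v\<in>K. B v \<in> sets borel"
    by (auto simp: cylinders_def)
  \<comment> \<open>A time occurring in only one of the cylinders is unconstrained in the
    other.\<close>
  define C where "C v = (if v \<in> J then A v else UNIV) \<inter> (if v \<in> K then B v else UNIV)" for v
  have "a \<inter> b = {\<omega>\<in>space M. \<forall>v\<in>J \<union> K. X v \<omega> \<in> C v}"
    unfolding a b by (auto simp: C_def split: if_splits)
  moreover have "\<forall>v\<in>J \<union> K. C v \<in> sets borel"
    using a b by (auto simp: C_def)
  ultimately show "a \<inter> b \<in> cylinders u"
    unfolding cylinders_def using a b by (intro CollectI exI[of _ "J \<union> K"] exI[of _ C]) simp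
qed

text \<open>\<^const>\<open>indep_var\<close> wants both variables in the same type, hence the dummy component.\<close>
lemma indep_past_increment:
  assumes us: "0 \<le> u" "u \<le> s" and R: "R \<in> measurable (past u) (borel :: (real \<times> real) measure)"
  shows "indep_var borel R borel (\<lambda>\<omega>. (X s \<omega> - X u \<omega>, 0))"
proof -
  have XM [measurable]: "X u \<in> borel_measurable M" "X s \<in> borel_measurable M"
    using us levy by (auto simp: levy_process_def)
  have D_meas: "(\<lambda>\<omega>. (X s \<omega> - X u \<omega>, 0 :: real)) \<in> measurable M borel"
    by measurable
  let ?D = "{(\<lambda>\<omega>. (X s \<omega> - X u \<omega>, 0 :: real)) -` B \<inter> space M | B. B \<in> sets borel}"
  have D: "?D \<subseteq> sets M"
    using D_meas by (auto intro!: measurable_sets)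
  have "indep_set (cylinders u) ?D"
  proof (rule indep_setI[OF cylinders_sub D])
    fix a b assume "a \<in> cylinders u" "b \<in> ?D"
    then obtain J A B where a: "a = {\<omega>\<in>space M. \<forall>v\<in>J. X v \<omega> \<in> A v}" "finite J" "J \<subseteq> {0..u}" "\<forall>v\<in>J. A v \<in> sets borel"
      and b: "b = (\<lambda>\<omega>. (X s \<omega> - X u \<omega>, 0 :: real)) -` B \<inter> space M" "B \<in> sets borel"
      by (auto simp: cylinders_def)
    have "(\<lambda>x::real. (x, 0::real)) -` B \<inter> space borel \<in> sets borel"
      using b(2) by (intro measurable_sets[of _ borel borel]) auto
    then have B': "(\<lambda>x::real. (x, 0::real)) -` B \<in> sets borel"
      by simp
    have b': "b = {\<omega>\<in>space M. X s \<omega> - X u \<omega> \<in> (\<lambda>x::real. (x, 0::real)) -` B}"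
      unfolding b by auto
    show "prob (a \<inter> b) = prob a * prob b"
      unfolding a(1) b' using a B' us by (intro indep_cylinder_increment) auto
  qed
  moreover have "Int_stable ?D"
  proof (rule Int_stableI)
    fix a b assume "a \<in> ?D" "b \<in> ?D"
    then obtain A B where "a = (\<lambda>\<omega>. (X s \<omega> - X u \<omega>, 0 :: real)) -` A \<inter> space M" "A \<in> sets borel"
        "b = (\<lambda>\<omega>. (X s \<omega> - X u \<omega>, 0 :: real)) -` B \<inter> space M" "B \<in> sets borel"
      by auto
    then show "a \<inter> b \<in> ?D"
      by (intro CollectI exI[of _ "A \<inter> B"]) auto
  qed
  ultimately have ind: "indep_set (sigma_sets (space M) (cylinders u)) (sigma_sets (space M) ?D)"
    by (intro indep_set_sigma_sets Int_stable_cylinders)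
  have "R -` A \<inter> space M \<in> sets (past u)" if "A \<in> sets borel" for A
    using measurable_sets[OF R that] by simp
  then have "sigma_sets (space M) {R -` A \<inter> space M | A. A \<in> sets borel} \<subseteq> sigma_sets (space M) (cylinders u)"
    unfolding sets_past by (intro sigma_sets_mono) auto
  then have "indep_set (sigma_sets (space M) {R -` A \<inter> space M | A. A \<in> sets borel}) (sigma_sets (space M) ?D)"
    using ind unfolding indep_sets2_eq by blast
  moreover have "R \<in> measurable M borel"
    using R sets_past_sub[of u] by (auto simp: measurable_def)
  ultimately show ?thesis
    unfolding indep_var_eq using D_meas by auto
qed

text \<open>The Markov property in integrated form: independence lets the increment be integrated
  over a second copy of \<open>M\<close>, and stationarity gives it the law of
  \<open>Y (s - u)\<close>.\<close>

lemma nn_integral_past_increment: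
  assumes us: "0 \<le> u" "u \<le> s" and R: "R \<in> measurable (past u) (borel :: (real \<times> real) measure)"
    and [measurable]: "\<phi> \<in> borel_measurable (borel \<Otimes>\<^sub>M borel)"
  shows "(\<integral>\<^sup>+\<omega>. \<phi> (R \<omega>, X s \<omega> - X u \<omega>) \<partial>M) = (\<integral>\<^sup>+\<omega>. \<integral>\<^sup>+\<omega>'. \<phi> (R \<omega>, Y (s - u) \<omega>') \<partial>M \<partial>M)"
proof -
  let ?D = "\<lambda>\<omega>. (X s \<omega> - X u \<omega>, 0 :: real)"
  let ?D' = "\<lambda>\<omega>. (Y (s - u) \<omega>, 0 :: real)"
  have XM [measurable]: "X u \<in> borel_measurable M" "X s \<in> borel_measurable M"
    using us levy by (auto simp: levy_process_def)
  have ind: "indep_var borel R borel ?D"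
    by (rule indep_past_increment[OF us R])
  have RM [measurable]: "R \<in> measurable M borel"
    using indep_var_rv1[OF ind] .
  have "distr M borel (\<lambda>\<omega>. X s \<omega> - X u \<omega>) = distr M borel (Y (s - u))"
    using us levy by (auto simp: levy_process_def)
  \<comment> \<open>Equality of laws is carried along x \<mapsto> (x, 0) to match the padded
    increment.\<close>
  then have "distr (distr M borel (\<lambda>\<omega>. X s \<omega> - X u \<omega>)) borel (\<lambda>x. (x, 0 :: real))
    = distr (distr M borel (Y (s - u))) borel (\<lambda>x. (x, 0 :: real))"
    by simp
  then have D: "distr M borel ?D = distr M borel ?D'"
    by (simp add: distr_distr comp_def)
  interpret D: prob_space "distr M borel ?D'"
    by (rule prob_space_distr) simp
  have "(\<integral>\<^sup>+\<omega>. \<phi> (R \<omega>, X s \<omega> - X u \<omega>) \<partial>M)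
      = (\<integral>\<^sup>+x. \<phi> (fst x, fst (snd x)) \<partial>distr M (borel \<Otimes>\<^sub>M borel) (\<lambda>\<omega>. (R \<omega>, ?D \<omega>)))"
    by (simp add: nn_integral_distr)
  also have "\<dots> = (\<integral>\<^sup>+x. \<phi> (fst x, fst (snd x)) \<partial>(distr M borel R \<Otimes>\<^sub>M distr M borel ?D'))"
    using ind unfolding indep_var_distribution_eq D by simp
  also have "\<dots> = (\<integral>\<^sup>+x. \<integral>\<^sup>+y. \<phi> (x, fst y) \<partial>distr M borel ?D' \<partial>distr M borel R)"
    by (subst D.nn_integral_fst[symmetric]) auto
  also have "\<dots> = (\<integral>\<^sup>+x. \<integral>\<^sup>+\<omega>'. \<phi> (x, Y (s - u) \<omega>') \<partial>M \<partial>distr M borel R)"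
    by (intro nn_integral_cong) (simp add: nn_integral_distr)
  also have "\<dots> = (\<integral>\<^sup>+\<omega>. \<integral>\<^sup>+\<omega>'. \<phi> (R \<omega>, Y (s - u) \<omega>') \<partial>M \<partial>M)"
    by (subst nn_integral_distr) auto
  finally show ?thesis .
qed

lemma nn_integral_semigroup:
  assumes us: "0 \<le> u" "u \<le> s" and [measurable]: "h \<in> borel_measurable borel"
  shows "(\<integral>\<^sup>+\<omega>. \<integral>\<^sup>+\<omega>'. h (Y u \<omega> + Y (s - u) \<omega>') \<partial>M \<partial>M) = (\<integral>\<^sup>+\<omega>. h (Y s \<omega>) \<partial>M)"
proof -
  have [measurable]: "Y u \<in> borel_measurable (past u)"
    by (rule measurable_past[OF order_refl us(1)])
  have R: "(\<lambda>\<omega>. (Y u \<omega>, 0 :: real)) \<in> measurable (past u) borel"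
    by measurable
  have \<phi>: "(\<lambda>x. h (fst (fst x) + snd x)) \<in> borel_measurable ((borel :: (real \<times> real) measure) \<Otimes>\<^sub>M borel)"
    by measurable
  show ?thesis
    using nn_integral_past_increment[OF us R \<phi>] us by simp
qed

end

section \<open>Occupation integrals and convolution powers of the time--space law\<close>

lemma borel_measurable_indicator_Icc [measurable (raw)]:
  fixes a b f :: "'a \<Rightarrow> real"
  assumes [measurable]: "a \<in> borel_measurable M" "b \<in> borel_measurable M" "f \<in> borel_measurable M"
  shows "(\<lambda>x. indicator {a x..b x} (f x) :: ennreal) \<in> borel_measurable M"
proof -
  have "(\<lambda>x. if a x \<le> f x \<and> f x \<le> b x then 1 else 0 :: ennreal) \<in> borel_measurable M"
    by measurable
  then show ?thesis
    by (simp add: indicator_def)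
qed

text \<open>The shear r = s - u has Jacobian 1. It replaces two successive durations by the total
  time s and one of them.\<close>

lemma nn_integral_triangle:
  fixes F :: "real \<Rightarrow> real \<Rightarrow> ennreal"
  assumes [measurable]: "case_prod F \<in> borel_measurable (borel \<Otimes>\<^sub>M borel)"
  shows "(\<integral>\<^sup>+u. \<integral>\<^sup>+r. F u r \<partial>lborel \<partial>lborel) = (\<integral>\<^sup>+s. \<integral>\<^sup>+u. F u (s - u) \<partial>lborel \<partial>lborel)"
proof -
  have "(\<integral>\<^sup>+r. F u r \<partial>lborel) = (\<integral>\<^sup>+s. F u (s - u) \<partial>lborel)" for u
    by (subst nn_integral_real_affine[where c=1 and t="- u"]) auto
  then have "(\<integral>\<^sup>+u. \<integral>\<^sup>+r. F u r \<partial>lborel \<partial>lborel) = (\<integral>\<^sup>+u. \<integral>\<^sup>+s. F u (s - u) \<partial>lborel \<partial>lborel)"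
    by simp
  also have "\<dots> = (\<integral>\<^sup>+s. \<integral>\<^sup>+u. F u (s - u) \<partial>lborel \<partial>lborel)"
    by (rule lborel_pair.Fubini') measurable
  finally show ?thesis .
qed

lemma nn_integral_power_Icc:
  fixes s :: real
  assumes "0 \<le> s"
  shows "(\<integral>\<^sup>+u. indicator {0..s} u * ennreal (u ^ k / fact k) \<partial>lborel) = ennreal (s ^ Suc k / fact (Suc k))"
proof -
  have "(\<integral>\<^sup>+u. ennreal (u ^ k / fact k) * indicator {0..s} u \<partial>lborel)
      = ennreal (s ^ Suc k / fact (Suc k)) - ennreal (0 ^ Suc k / fact (Suc k))"
  proof (subst nn_integral_FTC_Icc[where F="\<lambda>u. u ^ Suc k / fact (Suc k)"])
    show "((\<lambda>u. u ^ Suc k / fact (Suc k)) has_real_derivative u ^ k / fact k) (at u)" for u :: real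
    proof -
      have "real (Suc k) * u ^ (Suc k - Suc 0) / fact (Suc k) = u ^ k / fact k"
        by (simp del: of_nat_Suc)
      then show ?thesis
        using DERIV_cdivide[OF DERIV_pow[of "Suc k" u], of "fact (Suc k)"] by (simp only:)
    qed
  qed (use assms in auto)
  then show ?thesis
    by (simp add: mult.commute)
qed

text \<open>\<open>iter_occ n p s\<close> is the volume of \<open>{(u\<^sub>1, \<dots>, u\<^sub>n). 0 \<le> u\<^sub>1 \<le> \<dots> \<le> u\<^sub>n \<le> s \<and> (\<forall>i. p u\<^sub>i)}\<close>.\<close>
primrec iter_occ :: "nat \<Rightarrow> (real \<Rightarrow> bool) \<Rightarrow> real \<Rightarrow> ennreal" where
  "iter_occ 0 p s = 1"
| "iter_occ (Suc n) p s = (\<integral>\<^sup>+u. indicator {0..s} u * (indicator (Collect p) u * iter_occ n p u) \<partial>lborel)"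

text \<open>Joint measurability in time and parameter is the form that survives the induction, since
  each level integrates the previous one over its time argument.\<close>

lemma measurable_iter_occ:
  assumes q [measurable]: "Measurable.pred (borel \<Otimes>\<^sub>M F) (\<lambda>(s, \<omega>). q \<omega> s)"
  shows "(\<lambda>(s, \<omega>). iter_occ n (q \<omega>) s) \<in> borel_measurable (borel \<Otimes>\<^sub>M F)"
proof (induction n)
  case 0
  then show ?case by simp
next
  case (Suc n)
  note [measurable] = Suc
  have ind: "indicator (Collect (q \<omega>)) u = (if (case (u, \<omega>) of (s, \<omega>) \<Rightarrow> q \<omega> s) then 1 else 0 :: ennreal)" for u \<omega>
    by (simp add: indicator_def)
  have "(\<lambda>(x, u). indicator {0..fst x} u * ((if (case (u, snd x) of (s, \<omega>) \<Rightarrow> q \<omega> s) then 1 else 0 :: ennreal)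
      * (case (u, snd x) of (s, \<omega>) \<Rightarrow> iter_occ n (q \<omega>) s)))
    \<in> borel_measurable ((borel \<Otimes>\<^sub>M F) \<Otimes>\<^sub>M lborel)"
    by measurable
  then have "(\<lambda>x. \<integral>\<^sup>+u. indicator {0..fst x} u * ((if (case (u, snd x) of (s, \<omega>) \<Rightarrow> q \<omega> s) then 1 else 0 :: ennreal)
      * (case (u, snd x) of (s, \<omega>) \<Rightarrow> iter_occ n (q \<omega>) s)) \<partial>lborel)
    \<in> borel_measurable (borel \<Otimes>\<^sub>M F)"
    by (rule lborel.borel_measurable_nn_integral)
  then show ?case
    by (simp add: case_prod_beta' ind)
qed

lemma measurable_iter_occ1:
  assumes "Measurable.pred borel p"
  shows "iter_occ n p \<in> borel_measurable borel"
proof -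
  \<comment> \<open>A one-point parameter space reduces this to the parametrised case.\<close>
  have "(\<lambda>(s, \<omega>::unit). iter_occ n p s) \<in> borel_measurable (borel \<Otimes>\<^sub>M count_space UNIV)"
    using measurable_compose[OF measurable_fst assms, of "count_space UNIV"]
    by (intro measurable_iter_occ) (simp add: case_prod_beta')
  from measurable_compose[OF measurable_Pair2'[of "()"] this] show ?thesis
    by simp
qed

lemma iter_occ_cong:
  assumes "\<And>u. 0 \<le> u \<Longrightarrow> u \<le> s \<Longrightarrow> p u = q u"
  shows "iter_occ n p s = iter_occ n q s"
  using assms
proof (induction n arbitrary: s)
  case (Suc n)
  then show ?case
    by (auto intro!: nn_integral_cong split: split_indicator)
qed simp

text \<open>Insert a free point v into an ordered chain with largest point u. If v lies above u, the
  chain is longer by one; if v lies below u, the induction hypothesis counts the places for v among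
  the remaining points.\<close>

lemma iter_occ_Suc_mult:
  assumes p [measurable]: "Measurable.pred borel p"
  shows "iter_occ 1 p s * iter_occ n p s = of_nat (Suc n) * iter_occ (Suc n) p s"
proof (induction n arbitrary: s)
  case 0
  then show ?case by simp
next
  case (Suc n)
  note measurable_iter_occ1[OF p, measurable]
  define i where "i u = (indicator (Collect p) u :: ennreal)" for u
  have [measurable]: "i \<in> borel_measurable borel"
    unfolding i_def by measurable
  let ?z = "\<lambda>u. i u * iter_occ n p u"
  have 1: "iter_occ (Suc m) p s = (\<integral>\<^sup>+u. indicator {0..s} u * (i u * iter_occ m p u) \<partial>lborel)" for m s
    by (simp add: i_def)
  have 11: "iter_occ 1 p s = (\<integral>\<^sup>+u. indicator {0..s} u * i u \<partial>lborel)" for s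
    by (simp add: i_def)
  have "iter_occ 1 p s * iter_occ (Suc n) p s
     = (\<integral>\<^sup>+u. \<integral>\<^sup>+v. indicator {0..s} v * i v * (indicator {0..s} u * ?z u) \<partial>lborel \<partial>lborel)"
    unfolding 11 1 by (simp add: nn_integral_cmult nn_integral_multc)
  also have "\<dots> = (\<integral>\<^sup>+u. \<integral>\<^sup>+v. indicator {0..s} u * ?z u * (indicator {0..u} v * i v)
        + indicator {0..s} v * i v * (indicator {0..v} u * ?z u) \<partial>lborel \<partial>lborel)"
  proof (rule nn_integral_cong, rule nn_integral_cong_AE)
    fix u :: real
    show "AE v in lborel. indicator {0..s} v * i v * (indicator {0..s} u * ?z u) = indicator {0..s} u * ?z u * (indicator {0..u} v * i v)
        + indicator {0..s} v * i v * (indicator {0..v} u * ?z u)"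
      using AE_lborel_singleton[of u]
      \<comment> \<open>Both closed cases contain the diagonal v = u, which is a null set.\<close>
      by eventually_elim (auto simp: mult_ac split: split_indicator)
  qed
  also have "\<dots> = (\<integral>\<^sup>+u. \<integral>\<^sup>+v. indicator {0..s} u * ?z u * (indicator {0..u} v * i v) \<partial>lborel \<partial>lborel)
      + (\<integral>\<^sup>+u. \<integral>\<^sup>+v. indicator {0..s} v * i v * (indicator {0..v} u * ?z u) \<partial>lborel \<partial>lborel)"
    by (simp add: nn_integral_add)
  also have "(\<integral>\<^sup>+u. \<integral>\<^sup>+v. indicator {0..s} v * i v * (indicator {0..v} u * ?z u) \<partial>lborel \<partial>lborel)
      = (\<integral>\<^sup>+v. \<integral>\<^sup>+u. indicator {0..s} v * i v * (indicator {0..v} u * ?z u) \<partial>lborel \<partial>lborel)"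
    by (rule lborel_pair.Fubini') measurable
  also have "\<dots> = (\<integral>\<^sup>+v. indicator {0..s} v * i v * iter_occ (Suc n) p v \<partial>lborel)"
    unfolding 1 by (simp add: nn_integral_cmult)
  also have "\<dots> = iter_occ (Suc (Suc n)) p s"
    unfolding 1[of "Suc n"] by (simp add: mult_ac)
  also have "(\<integral>\<^sup>+u. \<integral>\<^sup>+v. indicator {0..s} u * ?z u * (indicator {0..u} v * i v) \<partial>lborel \<partial>lborel)
      = (\<integral>\<^sup>+u. indicator {0..s} u * ?z u * iter_occ 1 p u \<partial>lborel)"
    unfolding 11 by (simp add: nn_integral_cmult)
  also have "\<dots> = (\<integral>\<^sup>+u. of_nat (Suc n) * (indicator {0..s} u * (i u * iter_occ (Suc n) p u)) \<partial>lborel)"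
  proof (intro nn_integral_cong)
    fix u
    have "indicator {0..s} u * ?z u * iter_occ 1 p u = indicator {0..s} u * i u * (iter_occ 1 p u * iter_occ n p u)"
      by (simp only: mult_ac)
    then show "indicator {0..s} u * ?z u * iter_occ 1 p u = of_nat (Suc n) * (indicator {0..s} u * (i u * iter_occ (Suc n) p u))"
      unfolding Suc by (simp only: mult_ac)
  qed
  also have "\<dots> = of_nat (Suc n) * iter_occ (Suc (Suc n)) p s"
    unfolding 1[of "Suc n"] by (intro nn_integral_cmult) measurable
  finally show ?case
    by (simp add: distrib_right add_ac)
qed

lemma iter_occ_power:
  assumes "Measurable.pred borel p"
  shows "iter_occ 1 p s ^ n = fact n * iter_occ n p s"
proof (induction n)
  case (Suc n)
  have "iter_occ 1 p s ^ Suc n = fact n * (iter_occ 1 p s * iter_occ n p s)"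
    unfolding power_Suc Suc by (simp only: mult_ac)
  then show ?case
    unfolding iter_occ_Suc_mult[OF assms] by (simp add: mult_ac)
qed simp

text \<open>Finiteness allows the volume to be stored as a real component of the past when the
  Markov property is applied.\<close>

lemma iter_occ_finite:
  assumes "Measurable.pred borel p"
  shows "iter_occ n p s < \<infinity>"
proof -
  have "iter_occ 1 p s \<le> (\<integral>\<^sup>+u. indicator {0..s} u \<partial>lborel)"
    unfolding One_nat_def iter_occ.simps
    by (intro nn_integral_mono) (auto split: split_indicator)
  also have "\<dots> < \<infinity>"
    by (cases "0 \<le> s") auto
  finally have "iter_occ 1 p s ^ n < \<infinity>"
    by (simp add: power_less_top_ennreal)
  moreover have "iter_occ n p s \<le> fact n * iter_occ n p s"
  proof -
    have "of_nat 1 \<le> (of_nat (fact n) :: ennreal)"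
      by (rule of_nat_mono) (rule fact_ge_1)
    then have "1 \<le> (fact n :: ennreal)"
      by (simp only: of_nat_1 of_nat_fact)
    from mult_right_mono[OF this, of "iter_occ n p s"] show ?thesis
      by simp
  qed
  ultimately show ?thesis
    unfolding iter_occ_power[OF assms] by (rule le_less_trans[rotated])
qed

section \<open>The time-space law cut at the horizon and its convolution powers\<close>

locale levy_occ = levy M X for M :: "'a measure" and X +
  fixes P :: "real \<Rightarrow> bool" and T :: real
  assumes P_meas [measurable]: "Measurable.pred borel P"
    and P_add: "\<And>x y. P x \<Longrightarrow> P y \<Longrightarrow> P (x + y)"
    and P_compl_add: "\<And>x y. \<not> P x \<Longrightarrow> \<not> P y \<Longrightarrow> \<not> P (x + y)"
    and T: "0 \<le> T"
begin

text \<open>Without the cut of time to [0, T] this measure would be infinite, since each position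
  law has mass 1.\<close>

definition \<Lambda> :: "(real \<times> real) measure" where
  "\<Lambda> = distr (density lborel (indicator {0..T}) \<Otimes>\<^sub>M M) borel (\<lambda>(r, \<omega>). (r, Y r \<omega>))"

definition U :: "(real \<times> real) set" where
  "U = {w. P (snd w)}"

lemma measurable_Y_comp [measurable (raw)]:
  assumes "f \<in> borel_measurable N" "g \<in> measurable N M"
  shows "(\<lambda>x. Y (f x) (g x)) \<in> borel_measurable N"
  using measurable_compose[OF measurable_Pair[OF assms] measurable_Y_pair] by simp

lemma finite_measure_Icc: "finite_measure (density lborel (indicator {0..T} :: real \<Rightarrow> ennreal))"
  using T by (intro finite_measureI) (simp add: emeasure_density)

lemma U_sets [measurable]: "U \<in> sets borel"
proof -
  have "{w \<in> space borel. P (snd (w :: real \<times> real))} \<in> sets borel"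
    by measurable
  then show ?thesis
    by (simp add: U_def)
qed

lemma measurable_Lam: "(\<lambda>(r, \<omega>). (r, Y r \<omega>)) \<in> measurable (density lborel (indicator {0..T}) \<Otimes>\<^sub>M M) (borel :: (real \<times> real) measure)"
  by measurable

sublocale S: spitzer \<Lambda> U
proof (rule spitzer.intro)
  have "finite_measure (density lborel (indicator {0..T} :: real \<Rightarrow> ennreal) \<Otimes>\<^sub>M M)"
    by (intro finite_measure_pair_measure finite_measure_Icc finite_measure_axioms)
  then interpret L: finite_measure "density lborel (indicator {0..T} :: real \<Rightarrow> ennreal) \<Otimes>\<^sub>M M" .
  show "finite_measure \<Lambda>"
    unfolding \<Lambda>_def by (rule L.finite_measure_distr[OF measurable_Lam])
qed (auto simp: \<Lambda>_def U_def P_add P_compl_add)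

lemma nn_integral_Lam:
  assumes [measurable]: "h \<in> borel_measurable borel"
  shows "(\<integral>\<^sup>+w. h w \<partial>\<Lambda>) = (\<integral>\<^sup>+r. indicator {0..T} r * (\<integral>\<^sup>+\<omega>. h (r, Y r \<omega>) \<partial>M) \<partial>lborel)"
proof -
  have "(\<integral>\<^sup>+w. h w \<partial>\<Lambda>) = (\<integral>\<^sup>+x. h (case x of (r, \<omega>) \<Rightarrow> (r, Y r \<omega>)) \<partial>(density lborel (indicator {0..T}) \<Otimes>\<^sub>M M))"
    unfolding \<Lambda>_def by (rule nn_integral_distr[OF measurable_Lam]) measurable
  also have "\<dots> = (\<integral>\<^sup>+r. \<integral>\<^sup>+\<omega>. h (r, Y r \<omega>) \<partial>M \<partial>density lborel (indicator {0..T}))"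
    by (subst nn_integral_fst[symmetric]) (auto intro!: measurable_compose[OF measurable_Lam])
  also have "\<dots> = (\<integral>\<^sup>+r. indicator {0..T} r * (\<integral>\<^sup>+\<omega>. h (r, Y r \<omega>) \<partial>M) \<partial>lborel)"
    by (intro nn_integral_density) measurable
  finally show ?thesis .
qed

lemma nn_integral_conv_return:
  assumes "finite_measure N" and [measurable_cong]: "sets N = sets borel"
    and [measurable]: "h \<in> borel_measurable (borel :: (real \<times> real) measure)"
  shows "(\<integral>\<^sup>+w. h w \<partial>(N \<star> return borel 0)) = (\<integral>\<^sup>+w. h w \<partial>N)"
  using assms
  by (subst convolution_commutative)
    (auto simp: S.nn_integral_return_convolution prob_space.finite_measure prob_space_return)

text \<open>The k + 1 durations with total u fill a simplex of volume u^k / k!. However u is divided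
  among them, the independent displacements add up to the law of \<open>Y u\<close> by the semigroup
  property. The condition on h hides the cut at T.\<close>

lemma nn_integral_pw:
  assumes [measurable]: "h \<in> borel_measurable borel" and "\<And>w. T < fst w \<Longrightarrow> h w = 0"
  shows "(\<integral>\<^sup>+w. h w \<partial>S.pw (Suc k))
    = (\<integral>\<^sup>+u. indicator {0..T} u * ennreal (u ^ k / fact k) * (\<integral>\<^sup>+\<omega>. h (u, Y u \<omega>) \<partial>M) \<partial>lborel)"
  using assms
proof (induction k arbitrary: h)
  case 0
  note [measurable] = 0(1)
  show ?case
    by (simp add: nn_integral_conv_return S.finite_Lam nn_integral_Lam 0(1))
next
  case (Suc k)
  note [measurable] = Suc.prems(1)
  define G where "G s = (\<integral>\<^sup>+\<omega>. h (s, Y s \<omega>) \<partial>M)" for s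
  have [measurable]: "G \<in> borel_measurable borel"
    unfolding G_def by measurable
  have G0: "G s = 0" if "T < s" for s
    using Suc.prems(2)[of "(s, _)"] that by (simp add: G_def)
  let ?c = "\<lambda>u. ennreal (u ^ k / fact k)"
  have "(\<integral>\<^sup>+w. h w \<partial>S.pw (Suc (Suc k))) = (\<integral>\<^sup>+w. \<integral>\<^sup>+w'. h (w + w') \<partial>S.pw (Suc k) \<partial>\<Lambda>)"
    unfolding S.pw.simps(2)[of "Suc k"]
    by (intro nn_integral_convolution S.finite_Lam S.finite_pw) auto
  also have "\<dots> = (\<integral>\<^sup>+r. indicator {0..T} r * (\<integral>\<^sup>+\<omega>. \<integral>\<^sup>+w'. h ((r, Y r \<omega>) + w') \<partial>S.pw (Suc k) \<partial>M) \<partial>lborel)"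
    by (intro nn_integral_Lam S.measurable_nn_integral_shift S.finite_pw S.sets_pw Suc.prems)
  also have "\<dots> = (\<integral>\<^sup>+r. indicator {0..T} r * (\<integral>\<^sup>+\<omega>. \<integral>\<^sup>+u. indicator {0..T} u * ?c u *
      (\<integral>\<^sup>+\<omega>'. h ((r, Y r \<omega>) + (u, Y u \<omega>')) \<partial>M) \<partial>lborel \<partial>M) \<partial>lborel)"
  proof (intro nn_integral_cong)
    fix r
    have "(\<integral>\<^sup>+\<omega>. \<integral>\<^sup>+w'. h ((r, Y r \<omega>) + w') \<partial>S.pw (Suc k) \<partial>M) = (\<integral>\<^sup>+\<omega>. \<integral>\<^sup>+u. indicator {0..T} u * ?c u *
      (\<integral>\<^sup>+\<omega>'. h ((r, Y r \<omega>) + (u, Y u \<omega>')) \<partial>M) \<partial>lborel \<partial>M)" if "0 \<le> r"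
      \<comment> \<open>For r \<ge> 0, shifting time by r preserves vanishing beyond T, so the
        hypothesis covers the translated test function.\<close>
      using that by (intro nn_integral_cong Suc.IH) (auto intro!: Suc.prems(2))
    then show "indicator {0..T} r * (\<integral>\<^sup>+\<omega>. \<integral>\<^sup>+w'. h ((r, Y r \<omega>) + w') \<partial>S.pw (Suc k) \<partial>M)
        = indicator {0..T} r * (\<integral>\<^sup>+\<omega>. \<integral>\<^sup>+u. indicator {0..T} u * ?c u *
      (\<integral>\<^sup>+\<omega>'. h ((r, Y r \<omega>) + (u, Y u \<omega>')) \<partial>M) \<partial>lborel \<partial>M)"
      by (auto split: split_indicator)
  qed
  also have "\<dots> = (\<integral>\<^sup>+r. indicator {0..T} r * (\<integral>\<^sup>+u. indicator {0..T} u * ?c u * G (r + u) \<partial>lborel) \<partial>lborel)"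
  proof (intro nn_integral_cong)
    fix r
    interpret lM: pair_sigma_finite M lborel ..
    have "(\<integral>\<^sup>+\<omega>. \<integral>\<^sup>+u. indicator {0..T} u * ?c u * (\<integral>\<^sup>+\<omega>'. h ((r, Y r \<omega>) + (u, Y u \<omega>')) \<partial>M) \<partial>lborel \<partial>M)
      = (\<integral>\<^sup>+u. \<integral>\<^sup>+\<omega>. indicator {0..T} u * ?c u * (\<integral>\<^sup>+\<omega>'. h ((r, Y r \<omega>) + (u, Y u \<omega>')) \<partial>M) \<partial>M \<partial>lborel)"
      by (rule lM.Fubini'[symmetric]) measurable
    also have "\<dots> = (\<integral>\<^sup>+u. indicator {0..T} u * ?c u * (\<integral>\<^sup>+\<omega>. \<integral>\<^sup>+\<omega>'. h ((r, Y r \<omega>) + (u, Y u \<omega>')) \<partial>M \<partial>M) \<partial>lborel)"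
      by (intro nn_integral_cong nn_integral_cmult) measurable
    also have "\<dots> = (\<integral>\<^sup>+u. indicator {0..T} u * ?c u * G (r + u) \<partial>lborel)" if "0 \<le> r"
    proof (intro nn_integral_cong)
      fix u
      have "(\<integral>\<^sup>+\<omega>. \<integral>\<^sup>+\<omega>'. h ((r, Y r \<omega>) + (u, Y u \<omega>')) \<partial>M \<partial>M) = G (r + u)" if "0 \<le> u"
        using nn_integral_semigroup[of r "r + u" "\<lambda>y. h (r + u, y)"] that \<open>0 \<le> r\<close>
        by (simp add: G_def)
      then show "indicator {0..T} u * ?c u * (\<integral>\<^sup>+\<omega>. \<integral>\<^sup>+\<omega>'. h ((r, Y r \<omega>) + (u, Y u \<omega>')) \<partial>M \<partial>M)
          = indicator {0..T} u * ?c u * G (r + u)"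
        by (auto split: split_indicator)
    qed
    finally show "indicator {0..T} r * (\<integral>\<^sup>+\<omega>. \<integral>\<^sup>+u. indicator {0..T} u * ?c u * (\<integral>\<^sup>+\<omega>'. h ((r, Y r \<omega>) + (u, Y u \<omega>')) \<partial>M) \<partial>lborel \<partial>M)
      = indicator {0..T} r * (\<integral>\<^sup>+u. indicator {0..T} u * ?c u * G (r + u) \<partial>lborel)"
      by (auto split: split_indicator)
  qed
  also have "\<dots> = (\<integral>\<^sup>+r. \<integral>\<^sup>+u. indicator {0..T} r * (indicator {0..T} u * ?c u * G (r + u)) \<partial>lborel \<partial>lborel)"
    by (simp add: nn_integral_cmult)
  also have "\<dots> = (\<integral>\<^sup>+u. \<integral>\<^sup>+r. indicator {0..T} r * (indicator {0..T} u * ?c u * G (r + u)) \<partial>lborel \<partial>lborel)"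
    by (rule lborel_pair.Fubini'[symmetric]) measurable
  also have "\<dots> = (\<integral>\<^sup>+s. \<integral>\<^sup>+u. indicator {0..T} (s - u) * (indicator {0..T} u * ?c u * G (s - u + u)) \<partial>lborel \<partial>lborel)"
    by (rule nn_integral_triangle) measurable
  also have "\<dots> = (\<integral>\<^sup>+s. indicator {0..T} s * G s * (\<integral>\<^sup>+u. indicator {0..s} u * ?c u \<partial>lborel) \<partial>lborel)"
  proof (intro nn_integral_cong)
    fix s
    have "(\<integral>\<^sup>+u. indicator {0..T} (s - u) * (indicator {0..T} u * ?c u * G (s - u + u)) \<partial>lborel)
        = (\<integral>\<^sup>+u. indicator {0..T} s * G s * (indicator {0..s} u * ?c u) \<partial>lborel)"
    proof (rule nn_integral_cong)
      fix u
      show "indicator {0..T} (s - u) * (indicator {0..T} u * ?c u * G (s - u + u)) = indicator {0..T} s * G s * (indicator {0..s} u * ?c u)"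
        \<comment> \<open>For s \<le> T the bounds by T follow from 0 \<le> u \<le> s; for s > T
          both sides vanish because \<open>G s\<close> does.\<close>
        using G0[of s] by (cases "T < s") (auto split: split_indicator simp: mult_ac)
    qed
    then show "(\<integral>\<^sup>+u. indicator {0..T} (s - u) * (indicator {0..T} u * ?c u * G (s - u + u)) \<partial>lborel)
        = indicator {0..T} s * G s * (\<integral>\<^sup>+u. indicator {0..s} u * ?c u \<partial>lborel)"
      by (simp add: nn_integral_cmult)
  qed
  also have "\<dots> = (\<integral>\<^sup>+u. indicator {0..T} u * ennreal (u ^ Suc k / fact (Suc k)) * G u \<partial>lborel)"
    by (intro nn_integral_cong)
      (auto simp: nn_integral_power_Icc mult_ac split: split_indicator simp del: fact_Suc power_Suc)
  finally show ?case
    unfolding G_def .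
qed

section \<open>The confined walk as a functional of the path\<close>

lemma measurable_P_Y: "Measurable.pred (borel \<Otimes>\<^sub>M M) (\<lambda>(s, \<omega>). P (Y s \<omega>))"
  by measurable

lemma measurable_P_Y_path:
  assumes "\<omega> \<in> space M"
  shows "Measurable.pred borel (\<lambda>s. P (Y s \<omega>))"
  using measurable_compose[OF measurable_Pair2'[OF assms] measurable_P_Y] by simp

lemma measurable_iter_occ_Y [measurable (raw)]:
  assumes "f \<in> borel_measurable N" "g \<in> measurable N M"
  shows "(\<lambda>x. iter_occ n (\<lambda>s. P (Y s (g x))) (f x)) \<in> borel_measurable N"
  using measurable_compose[OF measurable_Pair[OF assms] measurable_iter_occ[OF measurable_P_Y]] by simp

text \<open>The path stopped at u is right continuous and takes only values known at time u, so it
  is jointly measurable over \<open>past u\<close>. The volume up to u cannot tell it from the full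
  path.\<close>

lemma measurable_iter_occ_past:
  assumes u: "0 \<le> u"
  shows "(\<lambda>\<omega>. iter_occ n (\<lambda>s. P (Y s \<omega>)) u) \<in> borel_measurable (past u)"
proof -
  have cont: "continuous (at_right s) (\<lambda>s. Y (min u s) \<omega>)" if "\<omega> \<in> space (past u)" for s \<omega>
  proof (cases "s < u")
    case True
    have "((\<lambda>s. Y s \<omega>) \<longlongrightarrow> Y s \<omega>) (at_right s)"
      using right_continuous_Y[of \<omega> s] that by (simp add: continuous_within)
    moreover have "\<forall>\<^sub>F x in at_right s. Y x \<omega> = Y (min u x) \<omega>"
      using True by (intro eventually_at_rightI[of s u]) auto
    ultimately have "((\<lambda>s. Y (min u s) \<omega>) \<longlongrightarrow> Y s \<omega>) (at_right s)"
      by (rule Lim_transform_eventually)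
    then show ?thesis
      using True by (simp add: continuous_within)
  next
    case False
    have "\<forall>\<^sub>F x in at_right s. Y u \<omega> = Y (min u x) \<omega>"
      using False by (intro eventually_at_rightI[of s "s + 1"]) auto
    then have "((\<lambda>s. Y (min u s) \<omega>) \<longlongrightarrow> Y u \<omega>) (at_right s)"
      by (rule Lim_transform_eventually[OF tendsto_const])
    then show ?thesis
      using False by (simp add: continuous_within min_absorb1)
  qed
  have Ymin [measurable]: "(\<lambda>(s, \<omega>). Y (min u s) \<omega>) \<in> borel_measurable (borel \<Otimes>\<^sub>M past u)"
    by (rule measurable_pair_right_continuous[OF _ cont]) (auto intro!: measurable_past u)
  have "Measurable.pred (borel \<Otimes>\<^sub>M past u) (\<lambda>x. P (case x of (s, \<omega>) \<Rightarrow> Y (min u s) \<omega>))"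
    by measurable
  then have "Measurable.pred (borel \<Otimes>\<^sub>M past u) (\<lambda>(s, \<omega>). P (Y (min u s) \<omega>))"
    by (simp add: case_prod_beta')
  from measurable_iter_occ[OF this, of n] have *: "(\<lambda>(s, \<omega>). iter_occ n (\<lambda>s. P (Y (min u s) \<omega>)) s)
      \<in> borel_measurable (borel \<Otimes>\<^sub>M past u)" .
  have "(\<lambda>\<omega>. iter_occ n (\<lambda>s. P (Y (min u s) \<omega>)) u) \<in> borel_measurable (past u)"
    using measurable_compose[OF measurable_Pair1'[of u] *] by simp
  moreover have "iter_occ n (\<lambda>s. P (Y (min u s) \<omega>)) u = iter_occ n (\<lambda>s. P (Y s \<omega>)) u" for \<omega>
    by (rule iter_occ_cong) (simp add: min_absorb2)
  ultimately show ?thesis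
    by simp
qed

text \<open>Markov property at u with the whole occupation history as weight: the independent copy
  of the next increment is exchanged for the actual one, so the walk becomes the path
  itself.\<close>

lemma nn_integral_stay_past:
  assumes ur: "0 \<le> u" "0 \<le> r" and [measurable]: "h \<in> borel_measurable borel"
  shows "(\<integral>\<^sup>+\<omega>. indicator U (u, Y u \<omega>) * iter_occ m (\<lambda>v. P (Y v \<omega>)) u
        * (\<integral>\<^sup>+\<omega>'. h (Y u \<omega> + Y r \<omega>') \<partial>M) \<partial>M)
    = (\<integral>\<^sup>+\<omega>. indicator U (u, Y u \<omega>) * iter_occ m (\<lambda>v. P (Y v \<omega>)) u * h (Y (u + r) \<omega>) \<partial>M)"
proof -
  define Z where "Z \<omega> = iter_occ m (\<lambda>v. P (Y v \<omega>)) u" for \<omega>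
  have [measurable]: "Z \<in> borel_measurable (past u)"
    unfolding Z_def by (rule measurable_iter_occ_past[OF ur(1)])
  have [measurable]: "Y u \<in> borel_measurable (past u)"
    by (rule measurable_past[OF order_refl ur(1)])
  \<comment> \<open>The pair holds all that is needed from the past: the position at u and the
    occupation volume, made real to fit the type.\<close>
  have R: "(\<lambda>\<omega>. (Y u \<omega>, enn2real (Z \<omega>))) \<in> measurable (past u) borel"
    by measurable
  have \<phi>: "(\<lambda>x. indicator U (u, fst (fst x)) * ennreal (snd (fst x)) * h (fst (fst x) + snd x))
      \<in> borel_measurable ((borel :: (real \<times> real) measure) \<Otimes>\<^sub>M borel)"
    by measurable
  have Z: "ennreal (enn2real (Z \<omega>)) = iter_occ m (\<lambda>v. P (Y v \<omega>)) u" if "\<omega> \<in> space M" for \<omega>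
    unfolding Z_def using iter_occ_finite[OF measurable_P_Y_path[OF that], of m u] by simp
  have "(\<integral>\<^sup>+\<omega>. indicator U (u, Y u \<omega>) * ennreal (enn2real (Z \<omega>)) * h (Y u \<omega> + (X (u + r) \<omega> - X u \<omega>)) \<partial>M)
    = (\<integral>\<^sup>+\<omega>. \<integral>\<^sup>+\<omega>'. indicator U (u, Y u \<omega>) * ennreal (enn2real (Z \<omega>)) * h (Y u \<omega> + Y (u + r - u) \<omega>') \<partial>M \<partial>M)"
    using nn_integral_past_increment[OF ur(1) _ R \<phi>, of "u + r"] ur by simp
  also have "\<dots> = (\<integral>\<^sup>+\<omega>. indicator U (u, Y u \<omega>) * iter_occ m (\<lambda>v. P (Y v \<omega>)) u
        * (\<integral>\<^sup>+\<omega>'. h (Y u \<omega> + Y r \<omega>') \<partial>M) \<partial>M)"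
    by (intro nn_integral_cong) (simp add: nn_integral_cmult Z)
  finally show ?thesis
    using ur by (simp add: Z cong: nn_integral_cong)
qed

text \<open>The partial sums of the confined walk are the positions of one path at ordered times.
  The endpoint (s, Y s) is kept, and the m earlier times are integrated out into
  \<open>iter_occ m\<close>.\<close>

lemma nn_integral_stay:
  assumes [measurable]: "h \<in> borel_measurable borel" and "\<And>w. T < fst w \<Longrightarrow> h w = 0"
  shows "(\<integral>\<^sup>+w. h w \<partial>S.stay (Suc m))
    = (\<integral>\<^sup>+s. indicator {0..T} s *
        (\<integral>\<^sup>+\<omega>. indicator U (s, Y s \<omega>) * iter_occ m (\<lambda>v. P (Y v \<omega>)) s * h (s, Y s \<omega>) \<partial>M) \<partial>lborel)"
  using assms
proof (induction m arbitrary: h)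
  case 0
  note [measurable] = 0(1)
  have "(\<integral>\<^sup>+w. h w \<partial>S.stay (Suc 0)) = (\<integral>\<^sup>+w. indicator U w * h w \<partial>(\<Lambda> \<star> return borel 0))"
    by (simp add: nn_integral_density)
  also have "\<dots> = (\<integral>\<^sup>+w. indicator U w * h w \<partial>\<Lambda>)"
    by (intro nn_integral_conv_return S.finite_Lam) auto
  also have "\<dots> = (\<integral>\<^sup>+s. indicator {0..T} s * (\<integral>\<^sup>+\<omega>. indicator U (s, Y s \<omega>) * h (s, Y s \<omega>) \<partial>M) \<partial>lborel)"
    by (intro nn_integral_Lam) measurable
  finally show ?case
    by simp
next
  case (Suc m)
  note [measurable] = Suc.prems(1)
  define h' where "h' w = indicator U w * h w" for w
  have h'_meas [measurable]: "h' \<in> borel_measurable borel"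
    unfolding h'_def by measurable
  have h'0: "h' w = 0" if "T < fst w" for w
    using Suc.prems(2)[OF that] by (simp add: h'_def)
  define g where "g w = (\<integral>\<^sup>+w'. h' (w + w') \<partial>\<Lambda>)" for w
  have g_eq: "g w = (\<integral>\<^sup>+r. indicator {0..T} r * (\<integral>\<^sup>+\<omega>. h' (fst w + r, snd w + Y r \<omega>) \<partial>M) \<partial>lborel)" for w
    unfolding g_def by (cases w) (simp add: nn_integral_Lam)
  have g_meas [measurable]: "g \<in> borel_measurable borel"
    unfolding g_def by (intro S.measurable_nn_integral_shift S.finite_Lam S.sets_Lam h'_meas)
  have g0: "g w = 0" if "T < fst w" for w
  proof -
    have "indicator {0..T} r * (\<integral>\<^sup>+\<omega>. h' (fst w + r, snd w + Y r \<omega>) \<partial>M) = 0" for r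
      using that h'0 by (auto split: split_indicator)
    then show ?thesis
      unfolding g_eq by (simp only: nn_integral_const mult_zero_left)
  qed
  let ?Z = "\<lambda>m s \<omega>. iter_occ m (\<lambda>v. P (Y v \<omega>)) s"
  have "(\<integral>\<^sup>+w. h w \<partial>S.stay (Suc (Suc m))) = (\<integral>\<^sup>+w. h' w \<partial>(\<Lambda> \<star> S.stay (Suc m)))"
    unfolding S.stay.simps(2)[of "Suc m"] h'_def by (intro nn_integral_density) auto
  \<comment> \<open>After commuting, the new step comes last and becomes the increment following the
    history described by the induction hypothesis.\<close>
  also have "(\<Lambda> \<star> S.stay (Suc m)) = (S.stay (Suc m) \<star> \<Lambda>)"
    by (intro convolution_commutative S.finite_all) auto
  also have "(\<integral>\<^sup>+w. h' w \<partial>(S.stay (Suc m) \<star> \<Lambda>)) = (\<integral>\<^sup>+w. g w \<partial>S.stay (Suc m))"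
    unfolding g_def by (intro nn_integral_convolution S.finite_all) auto
  also have "\<dots> = (\<integral>\<^sup>+u. indicator {0..T} u *
        (\<integral>\<^sup>+\<omega>. indicator U (u, Y u \<omega>) * ?Z m u \<omega> * g (u, Y u \<omega>) \<partial>M) \<partial>lborel)"
    by (intro Suc.IH g_meas g0)
  also have "\<dots> = (\<integral>\<^sup>+u. \<integral>\<^sup>+r. indicator {0..T} u * indicator {0..T} r *
        (\<integral>\<^sup>+\<omega>. indicator U (u, Y u \<omega>) * ?Z m u \<omega> * h' (u + r, Y (u + r) \<omega>) \<partial>M) \<partial>lborel \<partial>lborel)"
  proof (intro nn_integral_cong)
    fix u
    interpret lM: pair_sigma_finite lborel M ..
    have "(\<integral>\<^sup>+\<omega>. indicator U (u, Y u \<omega>) * ?Z m u \<omega> * g (u, Y u \<omega>) \<partial>M)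
      = (\<integral>\<^sup>+\<omega>. \<integral>\<^sup>+r. indicator U (u, Y u \<omega>) * ?Z m u \<omega> * (indicator {0..T} r *
            (\<integral>\<^sup>+\<omega>'. h' (u + r, Y u \<omega> + Y r \<omega>') \<partial>M)) \<partial>lborel \<partial>M)"
      unfolding g_eq by (intro nn_integral_cong) (simp add: nn_integral_cmult)
    also have "\<dots> = (\<integral>\<^sup>+r. \<integral>\<^sup>+\<omega>. indicator U (u, Y u \<omega>) * ?Z m u \<omega> * (indicator {0..T} r *
            (\<integral>\<^sup>+\<omega>'. h' (u + r, Y u \<omega> + Y r \<omega>') \<partial>M)) \<partial>M \<partial>lborel)"
      by (rule lM.Fubini') measurable
    also have "\<dots> = (\<integral>\<^sup>+r. indicator {0..T} r * (\<integral>\<^sup>+\<omega>. indicator U (u, Y u \<omega>) * ?Z m u \<omega> *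
            (\<integral>\<^sup>+\<omega>'. h' (u + r, Y u \<omega> + Y r \<omega>') \<partial>M) \<partial>M) \<partial>lborel)"
      by (intro nn_integral_cong, subst nn_integral_cmult[symmetric]) (auto intro!: nn_integral_cong simp: mult_ac)
    also have "\<dots> = (\<integral>\<^sup>+r. indicator {0..T} r * (\<integral>\<^sup>+\<omega>. indicator U (u, Y u \<omega>) * ?Z m u \<omega> *
            h' (u + r, Y (u + r) \<omega>) \<partial>M) \<partial>lborel)" if "0 \<le> u"
    proof (intro nn_integral_cong)
      fix r
      show "indicator {0..T} r * (\<integral>\<^sup>+\<omega>. indicator U (u, Y u \<omega>) * ?Z m u \<omega> * (\<integral>\<^sup>+\<omega>'. h' (u + r, Y u \<omega> + Y r \<omega>') \<partial>M) \<partial>M)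
        = indicator {0..T} r * (\<integral>\<^sup>+\<omega>. indicator U (u, Y u \<omega>) * ?Z m u \<omega> * h' (u + r, Y (u + r) \<omega>) \<partial>M)"
        using nn_integral_stay_past[OF that, of r "\<lambda>y. h' (u + r, y)" m] by (auto split: split_indicator)
    qed
    finally have "indicator {0..T} u * (\<integral>\<^sup>+\<omega>. indicator U (u, Y u \<omega>) * ?Z m u \<omega> * g (u, Y u \<omega>) \<partial>M)
      = indicator {0..T} u * (\<integral>\<^sup>+r. indicator {0..T} r * (\<integral>\<^sup>+\<omega>. indicator U (u, Y u \<omega>) * ?Z m u \<omega> *
            h' (u + r, Y (u + r) \<omega>) \<partial>M) \<partial>lborel)"
      by (auto split: split_indicator)
    also have "\<dots> = (\<integral>\<^sup>+r. indicator {0..T} u * indicator {0..T} r *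
        (\<integral>\<^sup>+\<omega>. indicator U (u, Y u \<omega>) * ?Z m u \<omega> * h' (u + r, Y (u + r) \<omega>) \<partial>M) \<partial>lborel)"
      by (subst nn_integral_cmult[symmetric]) (auto intro!: nn_integral_cong simp: mult_ac)
    finally show "indicator {0..T} u * (\<integral>\<^sup>+\<omega>. indicator U (u, Y u \<omega>) * ?Z m u \<omega> * g (u, Y u \<omega>) \<partial>M) = \<dots>" .
  qed
  \<comment> \<open>The new endpoint time s = u + r becomes the outer variable; the old endpoint u
    then joins the earlier times and raises m by one.\<close>
  also have "\<dots> = (\<integral>\<^sup>+s. \<integral>\<^sup>+u. indicator {0..T} u * indicator {0..T} (s - u) *
        (\<integral>\<^sup>+\<omega>. indicator U (u, Y u \<omega>) * ?Z m u \<omega> * h' (u + (s - u), Y (u + (s - u)) \<omega>) \<partial>M) \<partial>lborel \<partial>lborel)"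
    by (rule nn_integral_triangle) measurable
  also have "\<dots> = (\<integral>\<^sup>+s. indicator {0..T} s * (\<integral>\<^sup>+\<omega>. ?Z (Suc m) s \<omega> * h' (s, Y s \<omega>) \<partial>M) \<partial>lborel)"
  proof (intro nn_integral_cong)
    fix s
    interpret Ml: pair_sigma_finite M lborel ..
    have "(\<integral>\<^sup>+u. indicator {0..T} u * indicator {0..T} (s - u) *
        (\<integral>\<^sup>+\<omega>. indicator U (u, Y u \<omega>) * ?Z m u \<omega> * h' (u + (s - u), Y (u + (s - u)) \<omega>) \<partial>M) \<partial>lborel)
      = (\<integral>\<^sup>+u. indicator {0..T} s * (indicator {0..s} u *
        (\<integral>\<^sup>+\<omega>. indicator U (u, Y u \<omega>) * ?Z m u \<omega> * h' (s, Y s \<omega>) \<partial>M)) \<partial>lborel)"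
    proof (intro nn_integral_cong)
      fix u
      show "indicator {0..T} u * indicator {0..T} (s - u) *
        (\<integral>\<^sup>+\<omega>. indicator U (u, Y u \<omega>) * ?Z m u \<omega> * h' (u + (s - u), Y (u + (s - u)) \<omega>) \<partial>M)
        = indicator {0..T} s * (indicator {0..s} u *
        (\<integral>\<^sup>+\<omega>. indicator U (u, Y u \<omega>) * ?Z m u \<omega> * h' (s, Y s \<omega>) \<partial>M))"
        using h'0[of "(s, _)"] by (cases "T < s") (auto split: split_indicator)
    qed
    also have "\<dots> = indicator {0..T} s * (\<integral>\<^sup>+u. indicator {0..s} u *
        (\<integral>\<^sup>+\<omega>. indicator U (u, Y u \<omega>) * ?Z m u \<omega> * h' (s, Y s \<omega>) \<partial>M) \<partial>lborel)"
      by (intro nn_integral_cmult) measurable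
    also have "(\<integral>\<^sup>+u. indicator {0..s} u *
        (\<integral>\<^sup>+\<omega>. indicator U (u, Y u \<omega>) * ?Z m u \<omega> * h' (s, Y s \<omega>) \<partial>M) \<partial>lborel)
      = (\<integral>\<^sup>+u. \<integral>\<^sup>+\<omega>. indicator {0..s} u * (indicator U (u, Y u \<omega>) * ?Z m u \<omega>) * h' (s, Y s \<omega>) \<partial>M \<partial>lborel)"
      by (intro nn_integral_cong, subst nn_integral_cmult[symmetric]) (auto intro!: nn_integral_cong simp: mult_ac)
    also have "\<dots> = (\<integral>\<^sup>+\<omega>. \<integral>\<^sup>+u. indicator {0..s} u * (indicator U (u, Y u \<omega>) * ?Z m u \<omega>) * h' (s, Y s \<omega>) \<partial>lborel \<partial>M)"
      by (rule Ml.Fubini') measurable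
    also have "\<dots> = (\<integral>\<^sup>+\<omega>. ?Z (Suc m) s \<omega> * h' (s, Y s \<omega>) \<partial>M)"
    proof (intro nn_integral_cong)
      fix \<omega> assume [measurable]: "\<omega> \<in> space M"
      have "indicator U (u, Y u \<omega>) = (indicator (Collect (\<lambda>v. P (Y v \<omega>))) u :: ennreal)" for u
        by (simp add: U_def indicator_def)
      then have "?Z (Suc m) s \<omega> = (\<integral>\<^sup>+u. indicator {0..s} u * (indicator U (u, Y u \<omega>) * ?Z m u \<omega>) \<partial>lborel)"
        by simp
      then show "(\<integral>\<^sup>+u. indicator {0..s} u * (indicator U (u, Y u \<omega>) * ?Z m u \<omega>) * h' (s, Y s \<omega>) \<partial>lborel)
          = ?Z (Suc m) s \<omega> * h' (s, Y s \<omega>)"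
        by (simp only:) (rule nn_integral_multc, measurable)
    qed
    finally show "(\<integral>\<^sup>+u. indicator {0..T} u * indicator {0..T} (s - u) *
        (\<integral>\<^sup>+\<omega>. indicator U (u, Y u \<omega>) * ?Z m u \<omega> * h' (u + (s - u), Y (u + (s - u)) \<omega>) \<partial>M) \<partial>lborel)
      = indicator {0..T} s * (\<integral>\<^sup>+\<omega>. ?Z (Suc m) s \<omega> * h' (s, Y s \<omega>) \<partial>M)" .
  qed
  finally show ?case
    by (simp only: h'_def mult_ac)
qed

text \<open>Durations are nonnegative. This guarantees that a function vanishing beyond T is not
  brought back by adding the walk's time to some r > T.\<close>

lemma AE_stay_fst: "AE w in S.stay n. 0 \<le> fst w"
proof (cases n)
  case 0
  show ?thesis
    unfolding 0 S.stay.simps by (subst AE_return) auto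
next
  case (Suc m)
  have [measurable]: "{w::real \<times> real. fst w < 0} \<in> sets borel"
  proof -
    have "{w \<in> space (borel :: (real \<times> real) measure). fst w < 0} \<in> sets borel"
      by measurable
    then show ?thesis by simp
  qed
  have "(\<integral>\<^sup>+w. indicator {w. fst w < 0} w \<partial>S.stay (Suc m)) = 0"
  proof (subst nn_integral_stay)
    have "indicator {0..T} s * (\<integral>\<^sup>+\<omega>. indicator U (s, Y s \<omega>) * iter_occ m (\<lambda>v. P (Y v \<omega>)) s
       * indicator {w. fst w < 0} (s, Y s \<omega>) \<partial>M) = 0" for s
      by (auto split: split_indicator)
    then show "(\<integral>\<^sup>+s. indicator {0..T} s * (\<integral>\<^sup>+\<omega>. indicator U (s, Y s \<omega>) * iter_occ m (\<lambda>v. P (Y v \<omega>)) s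
       * indicator {w. fst w < 0} (s, Y s \<omega>) \<partial>M) \<partial>lborel) = 0"
      by (simp only: nn_integral_const mult_zero_left)
  qed (use T in auto)
  then have "AE w in S.stay (Suc m). w \<notin> {w. fst w < 0}"
    using sets_eq_imp_space_eq[OF S.sets_stay[of "Suc m"]]
    by (subst AE_iff_null) (simp_all add: null_sets_def del: S.stay.simps)
  then show ?thesis
    unfolding Suc by (auto elim!: eventually_mono)
qed

lemma nn_integral_iter_occ:
  "(\<integral>\<^sup>+\<omega>. iter_occ (Suc m) (\<lambda>v. P (Y v \<omega>)) T \<partial>M) = (\<integral>\<^sup>+w. indicator {..T} (fst w) \<partial>S.stay (Suc m))"
proof -
  interpret lM: pair_sigma_finite lborel M ..
  let ?Z = "\<lambda>m s \<omega>. iter_occ m (\<lambda>v. P (Y v \<omega>)) s"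
  have [measurable]: "(\<lambda>w. indicator {..T} (fst w) :: ennreal) \<in> borel_measurable (borel :: (real \<times> real) measure)"
    by (rule measurable_compose[of fst _ borel]) auto
  have "(\<integral>\<^sup>+w. indicator {..T} (fst w) \<partial>S.stay (Suc m))
    = (\<integral>\<^sup>+s. indicator {0..T} s * (\<integral>\<^sup>+\<omega>. indicator U (s, Y s \<omega>) * ?Z m s \<omega> * indicator {..T} (fst (s, Y s \<omega>)) \<partial>M) \<partial>lborel)"
    by (intro nn_integral_stay) auto
  also have "\<dots> = (\<integral>\<^sup>+s. \<integral>\<^sup>+\<omega>. indicator {0..T} s * (indicator U (s, Y s \<omega>) * ?Z m s \<omega>) \<partial>M \<partial>lborel)"
    by (intro nn_integral_cong, subst nn_integral_cmult) (auto intro!: nn_integral_cong split: split_indicator)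
  also have "\<dots> = (\<integral>\<^sup>+\<omega>. \<integral>\<^sup>+s. indicator {0..T} s * (indicator U (s, Y s \<omega>) * ?Z m s \<omega>) \<partial>lborel \<partial>M)"
    by (rule lM.Fubini'[symmetric]) measurable
  also have "\<dots> = (\<integral>\<^sup>+\<omega>. ?Z (Suc m) T \<omega> \<partial>M)"
    by (simp add: U_def indicator_def)
  finally show ?thesis ..
qed

end

section \<open>Convolutions over set partitions\<close>

lemma borel_measurable_indicator_Icc_real [measurable (raw)]:
  fixes a b f :: "'a \<Rightarrow> real"
  assumes [measurable]: "a \<in> borel_measurable M" "b \<in> borel_measurable M" "f \<in> borel_measurable M"
  shows "(\<lambda>x. indicator {a x..b x} (f x) :: real) \<in> borel_measurable M"
proof -
  have "(\<lambda>x. if a x \<le> f x \<and> f x \<le> b x then 1 else 0 :: real) \<in> borel_measurable M"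
    by measurable
  then show ?thesis
    by (simp add: indicator_def)
qed

text \<open>Functions to which the convolution integrals apply without junk values.\<close>
definition admissible :: "(real \<Rightarrow> real) \<Rightarrow> bool" where
  "admissible f \<longleftrightarrow> f \<in> borel_measurable borel \<and> (\<forall>t\<ge>0. 0 \<le> f t) \<and> (\<forall>t. \<exists>C. \<forall>s\<in>{0..t}. f s \<le> C)"

lemma admissibleD:
  assumes "admissible f"
  shows "f \<in> borel_measurable borel" "\<And>t. 0 \<le> t \<Longrightarrow> 0 \<le> f t"
  using assms by (auto simp: admissible_def)

lemma set_integral_Icc_bounded:
  fixes \<phi> :: "real \<Rightarrow> real"
  assumes [measurable]: "\<phi> \<in> borel_measurable borel"
    and nonneg: "\<And>s. 0 \<le> s \<Longrightarrow> s \<le> t \<Longrightarrow> 0 \<le> \<phi> s"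
    and bound: "\<And>s. 0 \<le> s \<Longrightarrow> s \<le> t \<Longrightarrow> \<phi> s \<le> C"
  shows "ennreal (LINT s:{0..t}|lborel. \<phi> s) = (\<integral>\<^sup>+s. indicator {0..t} s * ennreal (\<phi> s) \<partial>lborel)"
    and "0 \<le> t \<Longrightarrow> (LINT s:{0..t}|lborel. \<phi> s) \<le> C * t"
    and "0 \<le> (LINT s:{0..t}|lborel. \<phi> s)"
proof -
  have C: "integrable lborel (\<lambda>s. indicator {0..t} s *\<^sub>R C)"
    by (intro integrable_scaleR_left integrable_real_indicator) (auto simp: emeasure_lborel_Icc_eq)
  have int: "integrable lborel (\<lambda>s. indicator {0..t} s *\<^sub>R \<phi> s)"
    by (rule Bochner_Integration.integrable_bound[OF C])
      (auto simp: nonneg intro!: AE_I2 order_trans[OF bound abs_ge_self] split: split_indicator)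
  have "(\<integral>\<^sup>+s. ennreal (indicator {0..t} s *\<^sub>R \<phi> s) \<partial>lborel) = ennreal (LINT s:{0..t}|lborel. \<phi> s)"
    unfolding set_lebesgue_integral_def
    by (intro nn_integral_eq_integral int) (auto intro!: nonneg split: split_indicator)
  moreover have "(\<integral>\<^sup>+s. ennreal (indicator {0..t} s *\<^sub>R \<phi> s) \<partial>lborel) = (\<integral>\<^sup>+s. indicator {0..t} s * ennreal (\<phi> s) \<partial>lborel)"
    by (intro nn_integral_cong) (auto split: split_indicator)
  ultimately show "ennreal (LINT s:{0..t}|lborel. \<phi> s) = (\<integral>\<^sup>+s. indicator {0..t} s * ennreal (\<phi> s) \<partial>lborel)"
    by simp
  show "(LINT s:{0..t}|lborel. \<phi> s) \<le> C * t" if "0 \<le> t"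
  proof -
    have "(LINT s:{0..t}|lborel. \<phi> s) \<le> (\<integral>s. indicator {0..t} s *\<^sub>R C \<partial>lborel)"
      unfolding set_lebesgue_integral_def
      by (intro integral_mono int C) (auto intro!: bound split: split_indicator)
    also have "\<dots> = C * t"
      using that by simp
    finally show ?thesis .
  qed
  show "0 \<le> (LINT s:{0..t}|lborel. \<phi> s)"
    unfolding set_lebesgue_integral_def
    by (intro Bochner_Integration.integral_nonneg) (auto intro!: nonneg split: split_indicator)
qed

lemma admissible_bound:
  assumes "admissible f"
  shows "\<exists>C\<ge>0. \<forall>s\<in>{0..t}. f s \<le> C"
proof -
  from assms obtain C where C: "\<forall>s\<in>{0..t}. f s \<le> C"
    unfolding admissible_def by blast
  have "\<forall>s\<in>{0..t}. f s \<le> max C 0"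
    using C by (simp add: le_max_iff_disj)
  then show ?thesis
    by (intro exI[of _ "max C 0"] conjI) auto
qed

lemma ennreal_conv:
  assumes f: "admissible f" and g: "admissible g"
  shows "ennreal (conv f g t) = (\<integral>\<^sup>+v. indicator {0..t} v * ennreal (f (t - v) * g v) \<partial>lborel)"
proof -
  note [measurable] = admissibleD(1)[OF f] admissibleD(1)[OF g]
  obtain C where C: "0 \<le> C" "\<forall>s\<in>{0..t}. f s \<le> C"
    using admissible_bound[OF f] by blast
  obtain D where D: "0 \<le> D" "\<forall>s\<in>{0..t}. g s \<le> D"
    using admissible_bound[OF g] by blast
  show ?thesis
    unfolding conv_def
  proof (rule set_integral_Icc_bounded(1))
    fix s assume s: "0 \<le> s" "s \<le> t"
    show "0 \<le> f (t - s) * g s"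
      using s by (intro mult_nonneg_nonneg admissibleD(2)[OF f] admissibleD(2)[OF g]) auto
    have "f (t - s) \<le> C" "g s \<le> D"
      using s C(2) D(2) by auto
    then show "f (t - s) * g s \<le> C * D"
      using s C(1) by (intro mult_mono) (auto intro: admissibleD(2)[OF g])
  qed measurable
qed

lemma admissible_conv:
  assumes f: "admissible f" and g: "admissible g"
  shows "admissible (conv f g)"
proof -
  note [measurable] = admissibleD(1)[OF f] admissibleD(1)[OF g]
  have "(\<lambda>t. \<integral>s. indicator {0..t} s *\<^sub>R (f (t - s) * g s) \<partial>lborel) \<in> borel_measurable borel"
    by measurable
  then have "conv f g \<in> borel_measurable borel"
    by (simp add: conv_def[abs_def] set_lebesgue_integral_def)
  moreover have "0 \<le> conv f g t" for t
    unfolding conv_def set_lebesgue_integral_def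
  proof (intro Bochner_Integration.integral_nonneg)
    fix s
    show "0 \<le> indicator {0..t} s *\<^sub>R (f (t - s) * g s)"
      using admissibleD(2)[OF f, of "t - s"] admissibleD(2)[OF g, of s] by (cases "s \<in> {0..t}") simp_all
  qed
  moreover have "\<exists>C. \<forall>s\<in>{0..t}. conv f g s \<le> C" for t
  proof -
    obtain C where C: "0 \<le> C" "\<forall>s\<in>{0..t}. f s \<le> C"
      using admissible_bound[OF f] by blast
    obtain D where D: "0 \<le> D" "\<forall>s\<in>{0..t}. g s \<le> D"
      using admissible_bound[OF g] by blast
    have "conv f g s \<le> C * D * t" if "s \<in> {0..t}" for s
    proof -
      have "conv f g s \<le> C * D * s"
        unfolding conv_def
      proof (rule set_integral_Icc_bounded(2))
        fix v assume v: "0 \<le> v" "v \<le> s"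
        show "0 \<le> f (s - v) * g v"
          using v by (intro mult_nonneg_nonneg admissibleD(2)[OF f] admissibleD(2)[OF g]) auto
        have "f (s - v) \<le> C" "g v \<le> D"
          using v that C(2) D(2) by auto
        then show "f (s - v) * g v \<le> C * D"
          using v C(1) by (intro mult_mono) (auto intro: admissibleD(2)[OF g])
      qed (use that in \<open>measurable, simp\<close>)
      also have "\<dots> \<le> C * D * t"
        using C D that by (intro mult_left_mono) auto
      finally show ?thesis .
    qed
    then show ?thesis by blast
  qed
  ultimately show ?thesis
    by (simp add: admissible_def)
qed

text \<open>The empty list is excluded: its value is the zero function, which is not a unit of
  convolution.\<close>

lemma conv_list_Cons: "fs \<noteq> [] \<Longrightarrow> conv_list (f # fs) = conv f (conv_list fs)"
  by (cases fs) auto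

lemma admissible_conv_list: "(\<And>f. f \<in> set fs \<Longrightarrow> admissible f) \<Longrightarrow> admissible (conv_list fs)"
proof (induction fs)
  case Nil
  show ?case by (auto simp: admissible_def)
next
  case (Cons f fs)
  then show ?case
    by (cases "fs = []") (auto simp: conv_list_Cons intro: admissible_conv)
qed

lemma admissible_iconv: "(\<And>B. admissible (F B)) \<Longrightarrow> admissible (iconv \<rho> F)"
  unfolding iconv_def by (rule admissible_conv_list) auto

lemma conv_cong:
  assumes "\<And>u. 0 \<le> u \<Longrightarrow> f u = f' u" "\<And>u. 0 \<le> u \<Longrightarrow> g u = g' u"
  shows "conv f g t = conv f' g' t"
  unfolding conv_def set_lebesgue_integral_def
proof (intro Bochner_Integration.integral_cong refl)
  fix s
  show "indicator {0..t} s *\<^sub>R (f (t - s) * g s) = indicator {0..t} s *\<^sub>R (f' (t - s) * g' s)"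
    using assms[of "t - s"] assms[of s] by (cases "s \<in> {0..t}") simp_all
qed

text \<open>Convolution on [0, t] evaluates its arguments at nonnegative times only. This later
  allows \<open>Y\<close> to be turned back into \<open>X\<close>.\<close>

lemma iconv_cong:
  assumes "\<And>B u. 0 \<le> u \<Longrightarrow> F B u = G B u" "0 \<le> s"
  shows "iconv \<rho> F s = iconv \<rho> G s"
proof -
  have "conv_list (map F Bs) s = conv_list (map G Bs) s" if "0 \<le> s" for Bs s
    using that
  proof (induction Bs arbitrary: s)
    case (Cons B Bs)
    then show ?case
      using assms(1) by (cases "Bs = []") (auto simp: conv_list_Cons intro!: conv_cong)
  qed simp
  then show ?thesis
    using assms(2) by (simp add: iconv_def)
qed

text \<open>The block holding the least element of S has the least minimum, so it heads the list.
  Peeling it off is thus compatible with the fixed order of convolution.\<close>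

lemma blocks_list_insert:
  fixes S :: "nat set"
  assumes S: "finite S" "S \<noteq> {}" and B: "B \<subseteq> S" "Min S \<in> B" and \<rho>: "partition_on (S - B) \<rho>"
  shows "blocks_list (insert B \<rho>) = B # blocks_list \<rho>"
proof -
  have fin: "finite \<rho>" "finite B"
    using S B \<rho> by (auto intro: finite_elements[of "S - B"] finite_subset)
  have MinB: "Min B = Min S"
    using B S fin by (intro Min_eqI) auto
  have Min\<rho>: "Min C \<in> S - B" if "C \<in> \<rho>" for C
  proof -
    have "C \<subseteq> S - B" "C \<noteq> {}"
      using that \<rho> by (auto simp: partition_on_def)
    moreover have "finite C"
      using calculation S by (meson finite_Diff finite_subset)
    ultimately show ?thesis
      using Min_in by blast
  qed
  have lt: "Min S < x" if "x \<in> Min ` \<rho>" for x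
  proof -
    have "x \<in> S - B"
      using that Min\<rho> by auto
    then have "Min S \<le> x" "x \<noteq> Min S"
      using S B by auto
    then show ?thesis by simp
  qed
  have "Min S \<notin> Min ` \<rho>"
    using lt by blast
  then have sl: "sorted_list_of_set (Min ` insert B \<rho>) = Min S # sorted_list_of_set (Min ` \<rho>)"
    using fin lt by (simp add: MinB insort_is_Cons less_imp_le)
  have "C \<notin> \<rho>" if "Min S \<in> C" for C
    using that B \<rho> by (auto simp: partition_on_def)
  then have "(THE C. C \<in> insert B \<rho> \<and> Min S \<in> C) = B"
    using B by (intro the_equality) auto
  \<comment> \<open>The minima of the other blocks lie outside B, so adding B does not affect which
    block is chosen.\<close>
  moreover have "(THE C. C \<in> insert B \<rho> \<and> i \<in> C) = (THE C. C \<in> \<rho> \<and> i \<in> C)" if "i \<in> Min ` \<rho>" for i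
  proof -
    have "i \<notin> B"
      using that Min\<rho> by auto
    then show ?thesis
      by (intro arg_cong[where f=The]) auto
  qed
  ultimately show ?thesis
    unfolding blocks_list_def sl using fin by simp
qed

lemma iconv_insert:
  fixes S :: "nat set"
  assumes "finite S" "S \<noteq> {}" "B \<subseteq> S" "Min S \<in> B" "partition_on (S - B) \<rho>"
  shows "iconv (insert B \<rho>) F = (if B = S then F B else conv (F B) (iconv \<rho> F))"
proof -
  have fin: "finite \<rho>"
    using assms by (auto intro: finite_elements[of "S - B"])
  have "\<rho> = {} \<longleftrightarrow> B = S"
    using assms by (auto simp: partition_on_def)
  moreover have "blocks_list \<rho> = [] \<longleftrightarrow> \<rho> = {}"
    using fin by (auto simp: blocks_list_def)
  ultimately show ?thesis
    unfolding iconv_def blocks_list_insert[OF assms] by (auto simp: conv_list_Cons)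
qed

text \<open>A partition of S amounts to the block containing a together with a partition of the
  remaining points.\<close>

lemma sum_partitions_split:
  assumes "finite S" "a \<in> S"
  shows "(\<Sum>\<rho> | partition_on S \<rho>. f \<rho>)
    = (\<Sum>B | B \<subseteq> S \<and> a \<in> B. \<Sum>\<rho> | partition_on (S - B) \<rho>. f (insert B \<rho>))"
proof -
  let ?I = "SIGMA B:{B. B \<subseteq> S \<and> a \<in> B}. {\<rho>. partition_on (S - B) \<rho>}"
  have "bij_betw (\<lambda>(B, \<rho>). insert B \<rho>) ?I {\<rho>. partition_on S \<rho>}"
  proof (rule bij_betw_imageI)
    show "inj_on (\<lambda>(B, \<rho>). insert B \<rho>) ?I"
    proof (rule inj_onI, clarify)
      fix B \<rho> C \<sigma>
      assume B: "a \<in> B" "partition_on (S - B) \<rho>" and C: "a \<in> C" "partition_on (S - C) \<sigma>"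
        and eq: "insert B \<rho> = insert C \<sigma>"
      have "a \<notin> D" if "D \<in> \<sigma>" for D
        using that partition_onD1[OF C(2)] C(1) by blast
      moreover have "B \<in> insert C \<sigma>"
        using eq by blast
      ultimately have BC: "B = C"
        using B(1) by blast
      have "B \<notin> \<rho>" "C \<notin> \<sigma>"
        using partition_onD1[OF C(2)] C(1) partition_onD1[OF B(2)] B(1) by blast+
      then show "B = C \<and> \<rho> = \<sigma>"
        using eq BC insert_ident by metis
    qed
    show "(\<lambda>(B, \<rho>). insert B \<rho>) ` ?I = {\<rho>. partition_on S \<rho>}"
    proof (intro equalityI subsetI; clarify)
      fix B \<rho> assume *: "B \<subseteq> S" "a \<in> B" "partition_on (S - B) \<rho>"
      have "disjnt B (\<Union>\<rho>)"
        using partition_onD1[OF *(3)] by (auto simp: disjnt_def)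
      then show "partition_on S (insert B \<rho>)"
        using * by (subst partition_on_insert) auto
    next
      fix \<rho> assume \<rho>: "partition_on S \<rho>"
      then obtain B where B: "B \<in> \<rho>" "a \<in> B"
        using assms(2) partition_onD1[OF \<rho>] by blast
      have "disjnt B (\<Union>(\<rho> - {B}))"
        using partition_onD2[OF \<rho>] B(1) by (auto simp: disjoint_def disjnt_def)
      moreover have "insert B (\<rho> - {B}) = \<rho>"
        using B by blast
      ultimately have "partition_on (S - B) (\<rho> - {B})" "B \<subseteq> S"
        using \<rho> partition_on_insert[of B "\<rho> - {B}" S] by auto
      then show "\<rho> \<in> (\<lambda>(B, \<rho>). insert B \<rho>) ` ?I"
        using B by (intro image_eqI[of _ _ "(B, \<rho> - {B})"]) auto
    qed
  qed
  from sum.reindex_bij_betw[OF this, of f]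
  have "(\<Sum>\<rho> | partition_on S \<rho>. f \<rho>) = (\<Sum>x\<in>?I. f (case x of (B, \<rho>) \<Rightarrow> insert B \<rho>))" ..
  also have "\<dots> = (\<Sum>B | B \<subseteq> S \<and> a \<in> B. \<Sum>\<rho> | partition_on (S - B) \<rho>. f (insert B \<rho>))"
    using assms(1) by (subst sum.Sigma) (auto intro!: finitely_many_partition_on sum.cong)
  finally show ?thesis .
qed

text \<open>A set of size k through a is fixed by its k - 1 other elements, chosen among n.\<close>

lemma sum_subsets_containing:
  fixes \<phi> :: "nat \<Rightarrow> 'b::semiring_1"
  assumes "finite S" "a \<in> S" "card S = Suc n"
  shows "(\<Sum>B | B \<subseteq> S \<and> a \<in> B. \<phi> (card B)) = (\<Sum>k=1..Suc n. of_nat (n choose (k - 1)) * \<phi> k)"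
proof -
  let ?A = "S - {a}"
  have A: "finite ?A" "card ?A = n"
    using assms by auto
  have "(\<Sum>B | B \<subseteq> S \<and> a \<in> B. \<phi> (card B)) = (\<Sum>C\<in>Pow ?A. \<phi> (Suc (card C)))"
  proof (rule sum.reindex_bij_witness[of _ "insert a" "\<lambda>B. B - {a}"])
    fix B assume B: "B \<in> {B. B \<subseteq> S \<and> a \<in> B}"
    then have "finite B"
      using assms finite_subset by blast
    with B show "\<phi> (Suc (card (B - {a}))) = \<phi> (card B)"
      by (subst card_Suc_Diff1) auto
  qed (use assms in auto)
  also have "\<dots> = (\<Sum>j\<in>{0..n}. \<Sum>C\<in>{C \<in> Pow ?A. card C = j}. \<phi> (Suc (card C)))"
    using A by (intro sum.group[symmetric]) (auto intro!: card_mono[of ?A, THEN order_trans])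
  also have "\<dots> = (\<Sum>j\<in>{0..n}. of_nat (n choose j) * \<phi> (Suc j))"
  proof (intro sum.cong refl)
    fix j
    have "(\<Sum>C\<in>{C \<in> Pow ?A. card C = j}. \<phi> (Suc (card C))) = (\<Sum>C\<in>{C \<in> Pow ?A. card C = j}. \<phi> (Suc j))"
      by (intro sum.cong) auto
    also have "\<dots> = of_nat (n choose j) * \<phi> (Suc j)"
      using n_subsets[OF A(1), of j] A(2) by simp
    finally show "(\<Sum>C\<in>{C \<in> Pow ?A. card C = j}. \<phi> (Suc (card C))) = of_nat (n choose j) * \<phi> (Suc j)" .
  qed
  also have "\<dots> = (\<Sum>k=1..Suc n. of_nat (n choose (k - 1)) * \<phi> k)"
    by (rule sum.reindex_bij_witness[of _ "\<lambda>k. k - 1" Suc]) auto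
  finally show ?thesis .
qed

section \<open>The moment formula\<close>

context levy_occ
begin

definition prob_P :: "real \<Rightarrow> real" where
  "prob_P u = prob {\<omega>\<in>space M. P (Y u \<omega>)}"

lemma prob_P_nonneg [simp]: "0 \<le> prob_P u"
  by (simp add: prob_P_def)

definition block_fun :: "nat \<Rightarrow> real \<Rightarrow> real" where
  "block_fun k u = u ^ (k - 1) * prob_P u"

lemma nn_integral_U: "(\<integral>\<^sup>+\<omega>. indicator U (u, Y u \<omega>) \<partial>M) = ennreal (prob_P u)"
proof -
  have "(\<integral>\<^sup>+\<omega>. indicator U (u, Y u \<omega>) \<partial>M) = (\<integral>\<^sup>+\<omega>. indicator {\<omega>\<in>space M. P (Y u \<omega>)} \<omega> \<partial>M)"
    by (intro nn_integral_cong) (auto simp: U_def split: split_indicator)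
  also have "\<dots> = emeasure M {\<omega>\<in>space M. P (Y u \<omega>)}"
    by (intro nn_integral_indicator) measurable
  finally show ?thesis
    by (simp add: prob_P_def emeasure_eq_measure)
qed

lemma measurable_prob_P [measurable]: "prob_P \<in> borel_measurable borel"
proof -
  have "(\<lambda>u. enn2real (\<integral>\<^sup>+\<omega>. indicator U (u, Y u \<omega>) \<partial>M)) \<in> borel_measurable borel"
    by measurable
  then show ?thesis
    by (simp add: nn_integral_U)
qed

lemma admissible_block_fun: "admissible (block_fun k)"
proof -
  have "block_fun k s \<le> t ^ (k - 1)" if "s \<in> {0..t}" for s t
  proof -
    have "block_fun k s \<le> s ^ (k - 1) * 1"
      unfolding block_fun_def prob_P_def using that by (intro mult_left_mono prob_le_1) auto
    also have "\<dots> \<le> t ^ (k - 1)"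
      using that by (auto intro: power_mono)
    finally show ?thesis .
  qed
  moreover have "block_fun k \<in> borel_measurable borel"
    unfolding block_fun_def[abs_def] by measurable
  moreover have "0 \<le> block_fun k t" if "0 \<le> t" for t
    using that by (simp add: block_fun_def)
  ultimately show ?thesis
    unfolding admissible_def by blast
qed

text \<open>As g sees only time, the position in \<open>cyc k\<close> contributes just the
  probability of lying in \<open>U\<close>. The factorial cancels the denominator of the simplex
  volume.\<close>

lemma nn_integral_cyc_stay:
  assumes [measurable]: "g \<in> borel_measurable borel" and g0: "\<And>r. T < r \<Longrightarrow> g r = 0" and k: "1 \<le> k"
  shows "of_nat (fact (k - 1)) * (\<integral>\<^sup>+w. g (fst w) \<partial>(S.cyc k \<star> S.stay j))
    = (\<integral>\<^sup>+r. indicator {0..T} r * ennreal (block_fun k r) * (\<integral>\<^sup>+w. g (r + fst w) \<partial>S.stay j) \<partial>lborel)"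
proof -
  obtain i where i: "k = Suc i"
    using k by (cases k) auto
  define G where "G r = (\<integral>\<^sup>+w. g (r + fst w) \<partial>S.stay j)" for r
  interpret st: finite_measure "S.stay j"
    by (rule S.finite_stay)
  have [measurable]: "G \<in> borel_measurable borel"
    unfolding G_def by measurable
  have G0: "G r = 0" if "T < r" for r
  proof -
    \<comment> \<open>The walk's time is almost everywhere nonnegative, so adding it to r > T stays
      beyond T.\<close>
    have "AE w in S.stay j. g (r + fst w) = 0"
      using AE_stay_fst[of j] by eventually_elim (use that in \<open>auto intro!: g0\<close>)
    then show ?thesis
      unfolding G_def by (subst nn_integral_0_iff_AE) auto
  qed
  have "(\<integral>\<^sup>+w. g (fst w) \<partial>(S.cyc k \<star> S.stay j)) = (\<integral>\<^sup>+w. G (fst w) \<partial>S.cyc k)"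
    unfolding G_def by (subst nn_integral_convolution) (auto intro!: S.finite_all)
  also have "\<dots> = (\<integral>\<^sup>+w. indicator U w * G (fst w) \<partial>S.pw (Suc i))"
    unfolding i by (rule S.nn_integral_cyc) measurable
  also have "\<dots> = (\<integral>\<^sup>+u. indicator {0..T} u * ennreal (u ^ i / fact i) *
      (\<integral>\<^sup>+\<omega>. indicator U (u, Y u \<omega>) * G (fst (u, Y u \<omega>)) \<partial>M) \<partial>lborel)"
    by (rule nn_integral_pw) (auto simp: G0)
  also have "\<dots> = (\<integral>\<^sup>+u. indicator {0..T} u * ennreal (u ^ i / fact i) * (ennreal (prob_P u) * G u) \<partial>lborel)"
    by (simp add: nn_integral_multc nn_integral_U)
  also have "of_nat (fact (k - 1)) * \<dots>
      = (\<integral>\<^sup>+u. of_nat (fact i) * (indicator {0..T} u * ennreal (u ^ i / fact i) * (ennreal (prob_P u) * G u)) \<partial>lborel)"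
    unfolding i diff_Suc_1 by (rule nn_integral_cmult[symmetric]) measurable
  also have "\<dots> = (\<integral>\<^sup>+r. indicator {0..T} r * ennreal (block_fun k r) * G r \<partial>lborel)"
  proof (intro nn_integral_cong)
    fix u
    have "of_nat (fact i) * (ennreal (u ^ i / fact i) * ennreal (prob_P u)) = ennreal (block_fun k u)" if "0 \<le> u"
    proof -
      have "of_nat (fact i) * (ennreal (u ^ i / fact i) * ennreal (prob_P u)) = ennreal (fact i * (u ^ i / fact i * prob_P u))"
        unfolding ennreal_of_nat_eq_real_of_nat of_nat_fact using that
        by (subst ennreal_mult[symmetric] | simp add: prob_P_def)+
      then show ?thesis
        by (simp add: block_fun_def i)
    qed
    then have "indicator {0..T} u * (of_nat (fact i) * (ennreal (u ^ i / fact i) * ennreal (prob_P u))) * G u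
        = indicator {0..T} u * ennreal (block_fun k u) * G u"
      by (auto split: split_indicator)
    then show "of_nat (fact i) * (indicator {0..T} u * ennreal (u ^ i / fact i) * (ennreal (prob_P u) * G u))
        = indicator {0..T} u * ennreal (block_fun k u) * G u"
      by (simp only: mult_ac)
  qed
  finally show ?thesis
    unfolding G_def .
qed

text \<open>Convolving functions agrees with convolving their densities cut at T, as far as test
  functions vanishing beyond T can see.\<close>

lemma nn_integral_conv_mult:
  assumes [measurable]: "g \<in> borel_measurable borel" and g0: "\<And>r. T < r \<Longrightarrow> g r = 0"
    and f: "admissible f" and h: "admissible h"
  shows "(\<integral>\<^sup>+s. indicator {0..T} s * ennreal (conv f h s) * g s \<partial>lborel)
    = (\<integral>\<^sup>+r. indicator {0..T} r * ennreal (f r) * (\<integral>\<^sup>+v. indicator {0..T} v * ennreal (h v) * g (r + v) \<partial>lborel) \<partial>lborel)"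
proof -
  note [measurable] = admissibleD(1)[OF f] admissibleD(1)[OF h]
  have "(\<integral>\<^sup>+r. indicator {0..T} r * ennreal (f r) * (\<integral>\<^sup>+v. indicator {0..T} v * ennreal (h v) * g (r + v) \<partial>lborel) \<partial>lborel)
    = (\<integral>\<^sup>+r. \<integral>\<^sup>+v. indicator {0..T} r * ennreal (f r) * (indicator {0..T} v * ennreal (h v) * g (r + v)) \<partial>lborel \<partial>lborel)"
    by (simp add: nn_integral_cmult)
  also have "\<dots> = (\<integral>\<^sup>+v. \<integral>\<^sup>+r. indicator {0..T} r * ennreal (f r) * (indicator {0..T} v * ennreal (h v) * g (r + v)) \<partial>lborel \<partial>lborel)"
    by (rule lborel_pair.Fubini'[symmetric]) measurable
  also have "\<dots> = (\<integral>\<^sup>+s. \<integral>\<^sup>+v. indicator {0..T} (s - v) * ennreal (f (s - v)) * (indicator {0..T} v * ennreal (h v) * g (s - v + v)) \<partial>lborel \<partial>lborel)"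
    by (rule nn_integral_triangle) measurable
  also have "\<dots> = (\<integral>\<^sup>+s. \<integral>\<^sup>+v. indicator {0..T} s * g s * (indicator {0..s} v * ennreal (f (s - v) * h v)) \<partial>lborel \<partial>lborel)"
  proof (intro nn_integral_cong)
    fix s v
    show "indicator {0..T} (s - v) * ennreal (f (s - v)) * (indicator {0..T} v * ennreal (h v) * g (s - v + v))
      = indicator {0..T} s * g s * (indicator {0..s} v * ennreal (f (s - v) * h v))"
    proof (cases "0 \<le> v \<and> v \<le> s \<and> s \<le> T")
      case True
      then show ?thesis
        using admissibleD(2)[OF f, of "s - v"] admissibleD(2)[OF h, of v] by (simp add: ennreal_mult mult_ac)
    next
      case False
      then show ?thesis
        using g0[of s] by (auto split: split_indicator)
    qed
  qed
  also have "\<dots> = (\<integral>\<^sup>+s. indicator {0..T} s * ennreal (conv f h s) * g s \<partial>lborel)"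
    unfolding ennreal_conv[OF f h]
    by (intro nn_integral_cong, subst nn_integral_cmult) (simp_all add: mult_ac)
  finally show ?thesis ..
qed

text \<open>Strong induction that peels off the block of \<open>Min S\<close>. The set S is
  arbitrary because the points left over need not be an initial segment, and g is arbitrary because
  the peeled block shifts time.\<close>

lemma partition_formula:
  fixes S :: "nat set"
  assumes "finite S" "S \<noteq> {}"
    and "g \<in> borel_measurable borel" "\<And>r. T < r \<Longrightarrow> g r = 0"
  shows "of_nat (fact (card S)) * (\<integral>\<^sup>+w. g (fst w) \<partial>S.stay (card S))
    = (\<Sum>\<rho> | partition_on S \<rho>. \<integral>\<^sup>+s. indicator {0..T} s * ennreal (iconv \<rho> (\<lambda>B. block_fun (card B)) s) * g s \<partial>lborel)"
  using assms
proof (induction "card S" arbitrary: S g rule: less_induct)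
  case less
  note [measurable] = less.prems(3)
  note g0 = less.prems(4)
  let ?F = "\<lambda>B. block_fun (card B)"
  have admissible: "admissible (iconv \<rho> ?F)" for \<rho>
    by (intro admissible_iconv admissible_block_fun)
  note [measurable] = admissibleD(1)[OF admissible] admissibleD(1)[OF admissible_block_fun]
  obtain n where n: "card S = Suc n"
    using less.prems by (cases "card S") auto
  \<comment> \<open>\<open>J k\<close> pairs a block of size k with the confined walk on the
    remaining Suc n - k points; it depends on the block through its size only.\<close>
  define J where "J k = (\<integral>\<^sup>+r. indicator {0..T} r * ennreal (block_fun k r) * (\<integral>\<^sup>+w. g (r + fst w) \<partial>S.stay (Suc n - k)) \<partial>lborel)" for k
  have block: "(\<Sum>\<rho> | partition_on (S - B) \<rho>. \<integral>\<^sup>+s. indicator {0..T} s * ennreal (iconv (insert B \<rho>) ?F s) * g s \<partial>lborel)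
      = of_nat (fact (Suc n - card B)) * J (card B)" if B: "B \<subseteq> S" "Min S \<in> B" for B
  \<comment> \<open>The case B = S is outside the induction hypothesis: the empty partition has
    \<open>iconv\<close> equal to 0, whereas \<open>stay 0\<close> is a unit mass.\<close>
  proof (cases "B = S")
    case True
    have "(\<integral>\<^sup>+w. g (r + fst w) \<partial>S.stay 0) = g r" for r
    proof -
      have "(\<lambda>w::real \<times> real. g (r + fst w)) \<in> borel_measurable borel"
        by measurable
      then show ?thesis
        by (simp add: nn_integral_return)
    qed
    moreover have "iconv (insert S {}) ?F = block_fun (Suc n)"
      using iconv_insert[of S S "{}" ?F] less.prems n by (simp add: partition_on_empty)
    ultimately show ?thesis
      using n by (simp add: True partition_on_empty J_def del: S.stay.simps)
  next
    case False
    have card: "card (S - B) = Suc n - card B" "card (S - B) < card S" "S - B \<noteq> {}"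
    proof -
      have "finite B"
        using B less.prems finite_subset by blast
      then show "card (S - B) = Suc n - card B"
        using B n by (simp add: card_Diff_subset)
      show "S - B \<noteq> {}"
        using B False by blast
      show "card (S - B) < card S"
        using B less.prems by (intro psubset_card_mono) auto
    qed
    have "of_nat (fact (Suc n - card B)) * J (card B)
      = (\<integral>\<^sup>+r. of_nat (fact (Suc n - card B)) *
         (indicator {0..T} r * ennreal (block_fun (card B) r) * (\<integral>\<^sup>+w. g (r + fst w) \<partial>S.stay (Suc n - card B))) \<partial>lborel)"
    proof -
      interpret st: finite_measure "S.stay (Suc n - card B)"
        by (rule S.finite_stay)
      show ?thesis
        unfolding J_def by (rule nn_integral_cmult[symmetric]) measurable
    qed
    also have "\<dots> = (\<integral>\<^sup>+r. (\<Sum>\<rho> | partition_on (S - B) \<rho>. indicator {0..T} r * ennreal (block_fun (card B) r) *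
        (\<integral>\<^sup>+v. indicator {0..T} v * ennreal (iconv \<rho> ?F v) * g (r + v) \<partial>lborel)) \<partial>lborel)"
    proof (intro nn_integral_cong)
      fix r
      have "of_nat (fact (Suc n - card B)) * (\<integral>\<^sup>+w. g (r + fst w) \<partial>S.stay (Suc n - card B))
        = (\<Sum>\<rho> | partition_on (S - B) \<rho>. \<integral>\<^sup>+v. indicator {0..T} v * ennreal (iconv \<rho> ?F v) * g (r + v) \<partial>lborel)"
        if "0 \<le> r"
        \<comment> \<open>The hypothesis is used for the translate of g by r; for r \<ge> 0 it still
          vanishes beyond T.\<close>
        using less.hyps[OF card(2) _ card(3), of "\<lambda>v. g (r + v)"] less.prems(1) that
        unfolding card(1) by (simp add: g0)
      then have "indicator {0..T} r * ennreal (block_fun (card B) r) * (of_nat (fact (Suc n - card B)) * (\<integral>\<^sup>+w. g (r + fst w) \<partial>S.stay (Suc n - card B)))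
        = indicator {0..T} r * ennreal (block_fun (card B) r) * (\<Sum>\<rho> | partition_on (S - B) \<rho>. \<integral>\<^sup>+v. indicator {0..T} v * ennreal (iconv \<rho> ?F v) * g (r + v) \<partial>lborel)"
        by (auto split: split_indicator)
      then show "of_nat (fact (Suc n - card B)) *
         (indicator {0..T} r * ennreal (block_fun (card B) r) * (\<integral>\<^sup>+w. g (r + fst w) \<partial>S.stay (Suc n - card B)))
        = (\<Sum>\<rho> | partition_on (S - B) \<rho>. indicator {0..T} r * ennreal (block_fun (card B) r) *
        (\<integral>\<^sup>+v. indicator {0..T} v * ennreal (iconv \<rho> ?F v) * g (r + v) \<partial>lborel))"
        unfolding sum_distrib_left[symmetric] by (simp only: mult_ac)
    qed
    also have "\<dots> = (\<Sum>\<rho> | partition_on (S - B) \<rho>. \<integral>\<^sup>+r. indicator {0..T} r * ennreal (block_fun (card B) r) *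
        (\<integral>\<^sup>+v. indicator {0..T} v * ennreal (iconv \<rho> ?F v) * g (r + v) \<partial>lborel) \<partial>lborel)"
      by (rule nn_integral_sum) measurable
    also have "\<dots> = (\<Sum>\<rho> | partition_on (S - B) \<rho>. \<integral>\<^sup>+s. indicator {0..T} s * ennreal (iconv (insert B \<rho>) ?F s) * g s \<partial>lborel)"
    proof (intro sum.cong refl)
      fix \<rho> assume "\<rho> \<in> {\<rho>. partition_on (S - B) \<rho>}"
      then have ic: "iconv (insert B \<rho>) ?F = conv (block_fun (card B)) (iconv \<rho> ?F)"
        using iconv_insert[of S B \<rho> ?F] less.prems B False by simp
      show "(\<integral>\<^sup>+r. indicator {0..T} r * ennreal (block_fun (card B) r) *
        (\<integral>\<^sup>+v. indicator {0..T} v * ennreal (iconv \<rho> ?F v) * g (r + v) \<partial>lborel) \<partial>lborel)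
        = (\<integral>\<^sup>+s. indicator {0..T} s * ennreal (iconv (insert B \<rho>) ?F s) * g s \<partial>lborel)"
        unfolding ic by (rule nn_integral_conv_mult[symmetric, OF _ _ admissible_block_fun admissible]) (auto simp: g0)
    qed
    finally show ?thesis ..
  qed
  have g_fst: "(\<lambda>w::real \<times> real. g (fst w)) \<in> borel_measurable borel"
    by measurable
  have "of_nat (fact (card S)) * (\<integral>\<^sup>+w. g (fst w) \<partial>S.stay (card S))
    = of_nat (fact n) * (of_nat (Suc n) * (\<integral>\<^sup>+w. g (fst w) \<partial>S.stay (Suc n)))"
    unfolding n fact_Suc of_nat_id of_nat_mult by (simp only: mult_ac)
  also have "\<dots> = of_nat (fact n) * (\<Sum>k=1..Suc n. \<integral>\<^sup>+w. g (fst w) \<partial>(S.cyc k \<star> S.stay (Suc n - k)))"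
    unfolding S.spitzer_recursion[OF g_fst] ..
  also have "\<dots> = (\<Sum>k=1..Suc n. of_nat (n choose (k - 1)) * (of_nat (fact (Suc n - k)) * J k))"
    unfolding sum_distrib_left
  proof (intro sum.cong refl)
    fix k assume k: "k \<in> {1..Suc n}"
    have J: "J k = of_nat (fact (k - 1)) * (\<integral>\<^sup>+w. g (fst w) \<partial>(S.cyc k \<star> S.stay (Suc n - k)))"
      unfolding J_def using k by (intro nn_integral_cyc_stay[symmetric] g0) auto
    have "k - 1 \<le> n" "n - (k - 1) = Suc n - k"
      using k by auto
    \<comment> \<open>The factor n! divides into the number of blocks of size k through
      \<open>Min S\<close>, the factorial used by the hypothesis on the rest, and the (k - 1)!
      absorbed by the block function.\<close>
    then have "fact n = (n choose (k - 1)) * fact (Suc n - k) * fact (k - 1)"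
      using binomial_fact_lemma[of "k - 1" n] by (simp only: mult_ac)
    then have "(of_nat (fact n) :: ennreal) = of_nat (n choose (k - 1)) * of_nat (fact (Suc n - k)) * of_nat (fact (k - 1))"
      by (simp only: of_nat_mult)
    then show "of_nat (fact n) * (\<integral>\<^sup>+w. g (fst w) \<partial>(S.cyc k \<star> S.stay (Suc n - k)))
      = of_nat (n choose (k - 1)) * (of_nat (fact (Suc n - k)) * J k)"
      unfolding J by (simp only: mult_ac)
  qed
  also have "\<dots> = (\<Sum>B | B \<subseteq> S \<and> Min S \<in> B. of_nat (fact (Suc n - card B)) * J (card B))"
    using less.prems n by (intro sum_subsets_containing[symmetric]) auto
  also have "\<dots> = (\<Sum>B | B \<subseteq> S \<and> Min S \<in> B. \<Sum>\<rho> | partition_on (S - B) \<rho>.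
      \<integral>\<^sup>+s. indicator {0..T} s * ennreal (iconv (insert B \<rho>) ?F s) * g s \<partial>lborel)"
    by (intro sum.cong refl block[symmetric]) auto
  also have "\<dots> = (\<Sum>\<rho> | partition_on S \<rho>. \<integral>\<^sup>+s. indicator {0..T} s * ennreal (iconv \<rho> ?F s) * g s \<partial>lborel)"
    using less.prems by (intro sum_partitions_split[symmetric]) auto
  finally show ?case .
qed

end

section \<open>Return to real integrals and the partitions of one and two points\<close>

lemma set_integral_admissible:
  assumes "admissible f"
  shows "ennreal (LINT s:{0..t}|lborel. f s) = (\<integral>\<^sup>+s. indicator {0..t} s * ennreal (f s) \<partial>lborel)"
    and "0 \<le> (LINT s:{0..t}|lborel. f s)"
proof -
  obtain C where C: "\<forall>s\<in>{0..t}. f s \<le> C"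
    using admissible_bound[OF assms] by blast
  show "ennreal (LINT s:{0..t}|lborel. f s) = (\<integral>\<^sup>+s. indicator {0..t} s * ennreal (f s) \<partial>lborel)"
    by (rule set_integral_Icc_bounded(1)[where C=C]) (use C admissibleD[OF assms] in auto)
  show "0 \<le> (LINT s:{0..t}|lborel. f s)"
    by (rule set_integral_Icc_bounded(3)[where C=C]) (use C admissibleD[OF assms] in auto)
qed

lemma set_integral_Icc_cong:
  assumes "\<And>s. 0 \<le> s \<Longrightarrow> f s = g s"
  shows "(LINT s:{0..t::real}|lborel. f s) = (LINT s:{0..t}|lborel. (g s :: real))"
  unfolding set_lebesgue_integral_def
  by (intro Bochner_Integration.integral_cong) (auto simp: assms split: split_indicator)

lemma partition_on_singleton: "partition_on {a} \<rho> \<longleftrightarrow> \<rho> = {{a}}"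
proof
  assume \<rho>: "partition_on {a} \<rho>"
  have "B = {a}" if "B \<in> \<rho>" for B
  proof -
    have "B \<subseteq> {a}" "B \<noteq> {}"
      using that partition_onD1[OF \<rho>] partition_onD3[OF \<rho>] by blast+
    then show ?thesis by blast
  qed
  moreover have "\<rho> \<noteq> {}"
    using partition_onD1[OF \<rho>] by blast
  ultimately show "\<rho> = {{a}}"
    by blast
qed (simp add: partition_on_space)

lemma sum_iconv_1: "(\<Sum>\<rho> | partition_on {1..1} \<rho>. \<Phi> (iconv \<rho> F)) = \<Phi> (F {1})"
  using iconv_insert[of "{1}" "{1}" "{}" F]
  by (simp add: partition_on_singleton partition_on_empty)

lemma sum_iconv_2:
  "(\<Sum>\<rho> | partition_on {1..2} \<rho>. \<Phi> (iconv \<rho> F)) = \<Phi> (F {1, 2}) + \<Phi> (conv (F {1}) (F {2}))"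
proof -
  have S: "{1..2} = {1, 2::nat}"
    by auto
  have subsets: "{B. B \<subseteq> {1, 2} \<and> 1 \<in> B} = {{1}, {1, 2::nat}}"
    by auto
  have diff: "{1, 2} - {1} = {2::nat}" "{1, 2} - {1, 2} = ({}::nat set)" "{1} \<noteq> {1, 2::nat}"
    by auto
  have partitions: "Collect (partition_on {2::nat}) = {{{2}}}" "Collect (partition_on ({}::nat set)) = {{}}"
    by (auto simp: partition_on_singleton partition_on_empty)
  have 1: "iconv (insert {1, 2} {}) F = F {1, 2}"
    using iconv_insert[of "{1, 2}" "{1, 2}" "{}" F] by (simp add: partition_on_empty)
  have 2: "iconv (insert {1} {{2}}) F = conv (F {1}) (iconv {{2}} F)"
    using iconv_insert[of "{1, 2}" "{1}" "{{2}}" F] diff by (simp add: partition_on_singleton)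
  have 3: "iconv {{2}} F = F {2}"
    using iconv_insert[of "{2}" "{2}" "{}" F] by (simp add: partition_on_empty)
  have "(\<Sum>\<rho> | partition_on {1..2} \<rho>. \<Phi> (iconv \<rho> F))
    = (\<Sum>B\<in>{{1}, {1, 2}}. \<Sum>\<rho> | partition_on ({1, 2} - B) \<rho>. \<Phi> (iconv (insert B \<rho>) F))"
    unfolding S subsets[symmetric] by (rule sum_partitions_split) auto
  also have "\<dots> = \<Phi> (iconv (insert {1} {{2}}) F) + \<Phi> (iconv (insert {1, 2} {}) F)"
    using diff by (simp add: partitions del: One_nat_def insert_Diff_single)
  finally show ?thesis
    unfolding 1 2 3 by (simp add: add.commute)
qed

context levy_occ
begin

lemma ennreal_occ_time:
  assumes "\<omega> \<in> space M"
  shows "ennreal (occ_time P X T \<omega>) = iter_occ 1 (\<lambda>s. P (Y s \<omega>)) T" and "0 \<le> occ_time P X T \<omega>"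
proof -
  let ?\<phi> = "\<lambda>s. if P (Y s \<omega>) then 1 else 0 :: real"
  note [measurable] = measurable_P_Y_path[OF assms]
  have \<phi>: "?\<phi> \<in> borel_measurable borel"
    by measurable
  have occ: "occ_time P X T \<omega> = (LINT s:{0..T}|lborel. ?\<phi> s)"
    unfolding occ_time_def by (rule set_integral_Icc_cong) simp
  have "ennreal (LINT s:{0..T}|lborel. ?\<phi> s) = (\<integral>\<^sup>+s. indicator {0..T} s * ennreal (?\<phi> s) \<partial>lborel)"
    by (rule set_integral_Icc_bounded(1)[OF \<phi>, where C=1]) auto
  also have "\<dots> = iter_occ 1 (\<lambda>s. P (Y s \<omega>)) T"
    unfolding One_nat_def iter_occ.simps by (intro nn_integral_cong) (simp add: indicator_def)
  finally show "ennreal (occ_time P X T \<omega>) = iter_occ 1 (\<lambda>s. P (Y s \<omega>)) T"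
    unfolding occ .
  show "0 \<le> occ_time P X T \<omega>"
    unfolding occ by (rule set_integral_Icc_bounded(3)[OF \<phi>, where C=1]) auto
qed

lemma measurable_occ_time: "occ_time P X T \<in> borel_measurable M"
proof -
  have "(\<lambda>\<omega>. enn2real (iter_occ 1 (\<lambda>s. P (Y s \<omega>)) T)) \<in> borel_measurable M"
    by measurable
  then show ?thesis
    by (rule measurable_cong[THEN iffD1, rotated])
      (simp only: ennreal_occ_time(1)[symmetric] enn2real_ennreal ennreal_occ_time(2))
qed

lemma moment_formula:
  assumes "1 \<le> m"
  shows "(\<integral>\<omega>. occ_time P X T \<omega> ^ m \<partial>M) = (\<Sum>\<rho> | partition_on {1..m} \<rho>. LINT s:{0..T}|lborel.
      iconv \<rho> (\<lambda>B u. u ^ (card B - 1) * measure M {\<omega>\<in>space M. P (X u \<omega>)}) s)"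
proof -
  let ?F = "\<lambda>B. block_fun (card B)"
  have admissible: "admissible (iconv \<rho> ?F)" for \<rho>
    by (intro admissible_iconv admissible_block_fun)
  obtain n where m: "m = Suc n"
    using assms by (cases m) auto
  have "(\<integral>\<^sup>+\<omega>. ennreal (occ_time P X T \<omega> ^ m) \<partial>M) = (\<integral>\<^sup>+\<omega>. of_nat (fact m) * iter_occ m (\<lambda>s. P (Y s \<omega>)) T \<partial>M)"
    by (intro nn_integral_cong)
      (simp add: ennreal_power[symmetric] ennreal_occ_time iter_occ_power measurable_P_Y_path del: One_nat_def iter_occ.simps)
  also have "\<dots> = of_nat (fact m) * (\<integral>\<^sup>+\<omega>. iter_occ m (\<lambda>s. P (Y s \<omega>)) T \<partial>M)"
    by (rule nn_integral_cmult) measurable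
  also have "\<dots> = of_nat (fact (card {1..m})) * (\<integral>\<^sup>+w. indicator {..T} (fst w) \<partial>S.stay (card {1..m}))"
    by (simp only: m nn_integral_iter_occ card_atLeastAtMost diff_Suc_1)
  \<comment> \<open>The chosen test function vanishes beyond T, as required, and equals 1 on the
    range of integration.\<close>
  also have "\<dots> = (\<Sum>\<rho> | partition_on {1..m} \<rho>. \<integral>\<^sup>+s. indicator {0..T} s * ennreal (iconv \<rho> ?F s) * indicator {..T} s \<partial>lborel)"
    by (rule partition_formula) (use assms in auto)
  also have "\<dots> = (\<Sum>\<rho> | partition_on {1..m} \<rho>. ennreal (LINT s:{0..T}|lborel. iconv \<rho> ?F s))"
    unfolding set_integral_admissible(1)[OF admissible]
    by (intro sum.cong nn_integral_cong) (auto split: split_indicator)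
  also have "\<dots> = ennreal (\<Sum>\<rho> | partition_on {1..m} \<rho>. LINT s:{0..T}|lborel. iconv \<rho> ?F s)"
    by (rule sum_ennreal) (rule set_integral_admissible(2)[OF admissible])
  finally have nn: "(\<integral>\<^sup>+\<omega>. ennreal (occ_time P X T \<omega> ^ m) \<partial>M)
      = ennreal (\<Sum>\<rho> | partition_on {1..m} \<rho>. LINT s:{0..T}|lborel. iconv \<rho> ?F s)" .
  have "(\<integral>\<omega>. occ_time P X T \<omega> ^ m \<partial>M) = enn2real (\<integral>\<^sup>+\<omega>. ennreal (occ_time P X T \<omega> ^ m) \<partial>M)"
    using measurable_occ_time
    by (intro integral_eq_nn_integral borel_measurable_power AE_I2) (auto simp: ennreal_occ_time)
  also have "\<dots> = (\<Sum>\<rho> | partition_on {1..m} \<rho>. LINT s:{0..T}|lborel. iconv \<rho> ?F s)"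
    unfolding nn by (intro enn2real_ennreal sum_nonneg set_integral_admissible(2) admissible)
  also have "\<dots> = (\<Sum>\<rho> | partition_on {1..m} \<rho>. LINT s:{0..T}|lborel.
      iconv \<rho> (\<lambda>B u. u ^ (card B - 1) * measure M {\<omega>\<in>space M. P (X u \<omega>)}) s)"
    by (intro sum.cong refl set_integral_Icc_cong iconv_cong) (auto simp: block_fun_def prob_P_def)
  finally show ?thesis .
qed

lemma first_moment:
  "(\<integral>\<omega>. occ_time P X T \<omega> \<partial>M) = (LINT s:{0..T}|lborel. measure M {\<omega>\<in>space M. P (X s \<omega>)})"
  using moment_formula[of 1] sum_iconv_1[of "\<lambda>f. LINT s:{0..T}|lborel. f s"
      "\<lambda>B u. u ^ (card B - 1) * measure M {\<omega>\<in>space M. P (X u \<omega>)}"]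
  by simp

lemma second_moment:
  "(\<integral>\<omega>. occ_time P X T \<omega> ^ 2 \<partial>M) =
     (LINT s:{0..T}|lborel. s * measure M {\<omega>\<in>space M. P (X s \<omega>)}) +
     (LINT s:{0..T}|lborel. LINT u:{0..s}|lborel.
        measure M {\<omega>\<in>space M. P (X u \<omega>)} * measure M {\<omega>\<in>space M. P (X (s - u) \<omega>)})"
  using moment_formula[of 2] sum_iconv_2[of "\<lambda>f. LINT s:{0..T}|lborel. f s"
      "\<lambda>B u. u ^ (card B - 1) * measure M {\<omega>\<in>space M. P (X u \<omega>)}"]
  by (simp add: conv_def mult.commute)

end

theorem mainTheorem11:
  fixes M :: "'a measure" and X :: "real \<Rightarrow> 'a \<Rightarrow> real"
  assumes "levy_process M X"
  shows "\<forall>P \<in> {(\<lambda>x::real. 0 < x), (\<lambda>x::real. 0 \<le> x)}.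
    (\<forall>(m::nat) (t::real). 1 \<le> m \<longrightarrow> 0 < t \<longrightarrow>
       (\<integral>\<omega>. occ_time P X t \<omega> ^ m \<partial>M) =
       (\<Sum>\<rho> | partition_on {1..m} \<rho>.
          LINT s:{0..t}|lborel.
            iconv \<rho> (\<lambda>B u. u ^ (card B - 1) * measure M {\<omega>\<in>space M. P (X u \<omega>)}) s)) \<and>
    (\<forall>t::real. 0 < t \<longrightarrow>
       (\<integral>\<omega>. occ_time P X t \<omega> \<partial>M) =
       (LINT s:{0..t}|lborel. measure M {\<omega>\<in>space M. P (X s \<omega>)})) \<and>
    (\<forall>t::real. 0 < t \<longrightarrow>
       (\<integral>\<omega>. occ_time P X t \<omega> ^ 2 \<partial>M) =
       (LINT s:{0..t}|lborel. s * measure M {\<omega>\<in>space M. P (X s \<omega>)}) +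
       (LINT s:{0..t}|lborel. LINT u:{0..s}|lborel.
          measure M {\<omega>\<in>space M. P (X u \<omega>)} * measure M {\<omega>\<in>space M. P (X (s - u) \<omega>)}))"
proof
  fix P :: "real \<Rightarrow> bool"
  assume P: "P \<in> {(\<lambda>x::real. 0 < x), (\<lambda>x::real. 0 \<le> x)}"
  interpret prob_space M
    using assms by (simp add: levy_process_def)
  \<comment> \<open>Each of the two predicates defines a half-line bounded by 0, and so does its
    negation; all four half-lines are closed under addition.\<close>
  have loc: "levy_occ M X P t" if "0 < t" for t
  proof unfold_locales
    show "levy_process M X" by fact
    show "Measurable.pred borel P"
      using P by auto
  qed (use P that in auto)
  show "(\<forall>(m::nat) (t::real). 1 \<le> m \<longrightarrow> 0 < t \<longrightarrow>
       (\<integral>\<omega>. occ_time P X t \<omega> ^ m \<partial>M) =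
       (\<Sum>\<rho> | partition_on {1..m} \<rho>.
          LINT s:{0..t}|lborel.
            iconv \<rho> (\<lambda>B u. u ^ (card B - 1) * measure M {\<omega>\<in>space M. P (X u \<omega>)}) s)) \<and>
    (\<forall>t::real. 0 < t \<longrightarrow>
       (\<integral>\<omega>. occ_time P X t \<omega> \<partial>M) =
       (LINT s:{0..t}|lborel. measure M {\<omega>\<in>space M. P (X s \<omega>)})) \<and>
    (\<forall>t::real. 0 < t \<longrightarrow>
       (\<integral>\<omega>. occ_time P X t \<omega> ^ 2 \<partial>M) =
       (LINT s:{0..t}|lborel. s * measure M {\<omega>\<in>space M. P (X s \<omega>)}) +
       (LINT s:{0..t}|lborel. LINT u:{0..s}|lborel.
          measure M {\<omega>\<in>space M. P (X u \<omega>)} * measure M {\<omega>\<in>space M. P (X (s - u) \<omega>)}))"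
    by (intro conjI allI impI levy_occ.moment_formula levy_occ.first_moment levy_occ.second_moment loc)
qed

end
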